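(* Let $(a_i)_{i\in\mathbb{N}}$ be a sequence of points of $(-1,1)$ such that $S=\{a_i : i\in\mathbb{N}\}$ is dense in $(-1,1)$, and let $\mathcal{V}$ be the topological vector space defined below. Then the set of strongly transcendental functions is dense in $\mathcal{V}$.
   Context: A germ of a real function at a point $x$ is called weakly smooth if it has a representative $g$ such that for every $k\in\mathbb{N}$ there is a neighborhood of $x$ on which $g$ is $C^k$. $\mathcal{V}$ is the vector space of continuous functions $f\colon(-1,1)\to\mathbb{R}$ such that: (i) the germ of $f$ at every $x\in(-1,1)\setminus S$ is weakly smooth; (ii) for every $p\in\mathbb{N}$, $f$ is $C^p$ on some neighborhood of $a_p$; (iii) for every $a\in S$ and every $p\ge 0$, the one-sided limits $\lim_{x\to a^-}f^{(p)}(x)$ and $\lim_{x\to a^+}f^{(p)}(x)$ exist (here $f^{(p)}$ is defined on the dense open set $(-1,1)\setminus\{a_0,\dots,a_{p-1}\}$). $\mathcal{V}$ has the topology generated by the seminorms $\|f\|_{K,p}=\sup\{|f^{(q)}(x)| : x\in K\setminus S,\ 0\le q\le p\}$ (supremum $0$ if $K\subset S$), $K\subset(-1,1)$ compact, $p\in\mathbb{N}$. For $f\in\mathcal{V}$, $f^{(p)}(x^-)$ (resp. $f^{(p)}(x^+)$) denotes the extension to $(-1,1)$ by left-continuity (resp. right-continuity) of $x\mapsto f^{(p)}(x)$ on $(-1,1)\setminus\{a_0,\dots,a_{p-1}\}$. For $n,p,k\in\mathbb{N}$ with $p\ge k$ and $x=(x_1,\dots,x_n)$ with $x_i\in(-1,1)\setminus\{a_0,\dots,a_{p-1}\}$,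 $j_n^{p,k}f(x)$ is the tuple (with multiplicity) of: $f^{(q)}(x_i)$ for $0\le q\le p$, $1\le i\le n$; $f^{(q)}(a_i)$ for $0\le q\le i$, $0\le i\le k$; and $f^{(q)}(a_i^-), f^{(q)}(a_i^+)$ for $i<q\le p$, $0\le i\le k$. A function $f\in\mathcal{V}$ is strongly transcendental if for all $n,k\in\mathbb{N}$ and all tuples $x=(x_1,\dots,x_n)$ of pairwise distinct points of $(-1,1)\setminus S$ there exists $C\in\mathbb{N}$ such that for all $p\in\mathbb{N}$ with $p\ge k$, \[\operatorname{trdeg}_{\mathbb{Q}}\big(x,a_0,\dots,a_k,j_n^{p,k}f(x)\big)\ \ge\ n(p+2)+(k+1)(2p+3)-\frac{(k+1)(k+2)}{2}-C,\] where $\operatorname{trdeg}_{\mathbb{Q}}$ of a tuple of reals is the transcendence degree over $\mathbb{Q}$ of the field they generate.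
   Formalization: The points a_i are assumed pairwise distinct; if a_i = a_j with i < j, then taking n = 0, k = j the required transcendence degree bound fails for large p for every f, so no function is strongly transcendental and the claim is false. *)

theory Defs
  imports
    "HOL-Analysis.Analysis"
    "HOL-Library.Poly_Mapping"
    "HOL-Algebra.Generated_Fields"
    "HOL-Algebra.Algebraic_Closure_Type"
begin

subsection \<open>Transcendence degree over the rationals\<close>

text \<open>
  Polynomials over \<open>\<rat>\<close> with indeterminates indexed by real numbers are elements of
  \<^typ>\<open>(real \<Rightarrow>\<^sub>0 nat) \<Rightarrow>\<^sub>0 rat\<close>; evaluation substitutes for each indeterminate the real number
  that indexes it.
\<close>

definition rat_poly_eval :: "((real \<Rightarrow>\<^sub>0 nat) \<Rightarrow>\<^sub>0 rat) \<Rightarrow> real" where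
  "rat_poly_eval P =
    (\<Sum>m\<in>Poly_Mapping.keys P.
       of_rat (Poly_Mapping.lookup P m) *
       (\<Prod>b\<in>Poly_Mapping.keys m. b ^ Poly_Mapping.lookup m b))"

definition alg_indep_over_Rats :: "real set \<Rightarrow> bool" where
  "alg_indep_over_Rats B \<longleftrightarrow>
    (\<forall>P. (\<forall>m\<in>Poly_Mapping.keys P. Poly_Mapping.keys m \<subseteq> B) \<and> rat_poly_eval P = 0 \<longrightarrow> P = 0)"

text \<open>
  The largest cardinality of an algebraically independent subset; all infinite cardinalities are
  identified with \<open>\<infinity>\<close>.
\<close>

definition trdeg_over_Rats :: "real set \<Rightarrow> enat" where
  "trdeg_over_Rats L = (SUP B \<in> {B. B \<subseteq> L \<and> finite B \<and> alg_indep_over_Rats B}. enat (card B))"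

definition trdeg_tuple :: "real list \<Rightarrow> enat" where
  "trdeg_tuple ts = trdeg_over_Rats (generate_field (ring_of_type_algebra :: real ring) (set ts))"


subsection \<open>The space of functions\<close>

definition Ck_on :: "nat \<Rightarrow> (real \<Rightarrow> real) \<Rightarrow> real set \<Rightarrow> bool" where
  "Ck_on k f U \<longleftrightarrow>
    (\<forall>m<k. \<forall>x\<in>U. (deriv ^^ m) f differentiable (at x)) \<and> continuous_on U ((deriv ^^ k) f)"

definition weakly_smooth_germ :: "(real \<Rightarrow> real) \<Rightarrow> real \<Rightarrow> bool" where
  "weakly_smooth_germ f x \<longleftrightarrow>
    (\<exists>g. (\<forall>\<^sub>F y in nhds x. g y = f y) \<and> (\<forall>k. \<exists>U. open U \<and> x \<in> U \<and> Ck_on k g U))"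

text \<open>
  Functions on \<open>(-1,1)\<close> are represented by functions on \<open>\<real>\<close> that vanish outside \<open>(-1,1)\<close>.  For such
  functions, \<open>(deriv ^^ p) f\<close> is the \<open>p\<close>-th derivative on \<open>(-1,1) - {a 0, \<dots>, a (p - 1)}\<close>; its
  values at the finitely many remaining points of \<open>(-1,1)\<close> are meaningless, but they do not affect
  one-sided limits.
\<close>

definition V_space :: "(nat \<Rightarrow> real) \<Rightarrow> (real \<Rightarrow> real) set" where
  "V_space a = {f.
     (\<forall>x. x \<notin> {-1<..<1} \<longrightarrow> f x = 0) \<and>
     continuous_on {-1<..<1} f \<and>
     (\<forall>x\<in>{-1<..<1} - range a. weakly_smooth_germ f x) \<and>
     (\<forall>p. \<exists>U. open U \<and> a p \<in> U \<and> Ck_on p f U) \<and>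
     (\<forall>s\<in>range a. \<forall>p.
        (\<exists>l. ((deriv ^^ p) f \<longlongrightarrow> l) (at_left s)) \<and>
        (\<exists>l. ((deriv ^^ p) f \<longlongrightarrow> l) (at_right s)))}"

definition V_seminorm :: "(nat \<Rightarrow> real) \<Rightarrow> real set \<Rightarrow> nat \<Rightarrow> (real \<Rightarrow> real) \<Rightarrow> real" where
  "V_seminorm a K p f =
    (if K \<subseteq> range a then 0
     else Sup {\<bar>(deriv ^^ q) f x\<bar> | x q. x \<in> K - range a \<and> q \<le> p})"

definition V_topology :: "(nat \<Rightarrow> real) \<Rightarrow> (real \<Rightarrow> real) topology" where
  "V_topology a = topology_generated_by
     {{g \<in> V_space a. V_seminorm a K p (\<lambda>x. g x - f x) < e} | f K p e.
        f \<in> V_space a \<and> compact K \<and> K \<subseteq> {-1<..<1} \<and> e > 0}"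

lemma topspace_V_topology [simp]: "topspace (V_topology a) = V_space a"
proof -
  have "V_space a \<subseteq> topspace (V_topology a)"
  proof
    fix f assume f: "f \<in> V_space a"
    have "f \<in> {g \<in> V_space a. V_seminorm a {} 0 (\<lambda>x. g x - f x) < 1}"
      using f by (simp add: V_seminorm_def)
    moreover have "compact ({} :: real set)" "({} :: real set) \<subseteq> {-1<..<1}" "(1::real) > 0"
      by simp_all
    ultimately show "f \<in> topspace (V_topology a)"
      unfolding V_topology_def topology_generated_by_topspace using f by blast
  qed
  moreover have "topspace (V_topology a) \<subseteq> V_space a"
    unfolding V_topology_def topology_generated_by_topspace by blast
  ultimately show ?thesis by blast
qed


subsection \<open>Strong transcendence\<close>

definition left_nth_deriv :: "nat \<Rightarrow> (real \<Rightarrow> real) \<Rightarrow> real \<Rightarrow> real" where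
  "left_nth_deriv p f x = Lim (at_left x) ((deriv ^^ p) f)"

definition right_nth_deriv :: "nat \<Rightarrow> (real \<Rightarrow> real) \<Rightarrow> real \<Rightarrow> real" where
  "right_nth_deriv p f x = Lim (at_right x) ((deriv ^^ p) f)"

definition jet_tuple ::
    "(nat \<Rightarrow> real) \<Rightarrow> nat \<Rightarrow> nat \<Rightarrow> (real \<Rightarrow> real) \<Rightarrow> real list \<Rightarrow> real list" where
  "jet_tuple a p k f xs =
     [(deriv ^^ q) f x. x \<leftarrow> xs, q \<leftarrow> [0..<Suc p]] @
     [(deriv ^^ q) f (a i). i \<leftarrow> [0..<Suc k], q \<leftarrow> [0..<Suc i]] @
     [left_nth_deriv q f (a i). i \<leftarrow> [0..<Suc k], q \<leftarrow> [Suc i..<Suc p]] @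
     [right_nth_deriv q f (a i). i \<leftarrow> [0..<Suc k], q \<leftarrow> [Suc i..<Suc p]]"

definition strongly_transcendental :: "(nat \<Rightarrow> real) \<Rightarrow> (real \<Rightarrow> real) \<Rightarrow> bool" where
  "strongly_transcendental a f \<longleftrightarrow>
    (\<forall>n k xs. length xs = n \<and> distinct xs \<and> set xs \<subseteq> {-1<..<1} - range a \<longrightarrow>
      (\<exists>C::nat. \<forall>p\<ge>k.
         ereal (real n * (real p + 2) + (real k + 1) * (2 * real p + 3)
                - (real k + 1) * (real k + 2) / 2 - real C)
         \<le> ereal_of_enat (trdeg_tuple (xs @ map a [0..<Suc k] @ jet_tuple a p k f xs))))"

end

theory Submission
  imports Defs
begin

text \<open>
  Truncated powers \<open>(x - a\<^sub>j)\<^sub>+\<^sup>r / r!\<close> with \<open>r > j\<close> and monomials \<open>x\<^sup>s / s!\<close> have all their derivatives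
  bounded by 2 on \<open>(-1,1)\<close>, so every absolutely summable family of coefficients defines an element
  of \<open>\<V>\<close> that may be differentiated term by term.  Finite combinations are dense: going down from the
  top derivative, remove the finitely many jumps, approximate what is left by a polynomial, and
  integrate.

  Strong transcendence is then obtained from Baire's theorem in a compact box of coefficient
  sequences around a given finite combination.  That some tuple \<open>x\<close> has a jet of too small
  transcendence degree is a countable union of conditions, each of which is the projection of a
  compact set of pairs \<open>(c, x)\<close>, hence closed.  Each has dense complement: a finitely supported
  sequence whose coefficients are algebraically independent over \<open>\<rat>(S)\<close> avoids it, because
  \<open>x\<close>, the jets and the coefficients not involved in them determine all coefficients algebraically.
\<close>

text \<open>The points x are quantified after f and range over an uncountable set, so the
  coefficients cannot be chosen generic over Q(x) in advance. The count therefore treats x as data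
  of the same rank as the jets: x and its jet together must recover enough coefficients. This costs
  the n unknown points, and working over Q(S), where the centres of the truncated powers are
  constants, costs a_0, ..., a_k; both losses go into C = n + k + 1. Apart from them nothing is
  lost: a jet has as many entries as there are coefficients to recover. Baire's theorem is needed
  because recovering coefficients is algebra only for finite sums, whereas a finite sum is never
  strongly transcendental: its jets of all orders lie in one field of finite transcendence degree.
  Generic finite sums avoid one bad set at a time, and only an infinite series can avoid them all.
  The condition r > j is condition (ii) at a_j, since the derivative of order r is the only one of
  the truncated power that jumps there. It also leaves, for each order of differentiation, only
  finitely many exceptional points common to all terms of a series.\<close>

hide_const (open) up_ring.coeff up_ring.monom module.smult

subsection \<open>Algebraic closure inside the reals\<close>

abbreviation RR :: "real ring" where "RR \<equiv> ring_of_type_algebra"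

lemma field_RR: "field RR"
  by (rule field_from_type_algebra)

interpretation RR: domain RR
  by (rule field.axioms(1)[OF field_RR])

lemma RR_simps [simp]:
  "carrier RR = UNIV" "x \<otimes>\<^bsub>RR\<^esub> y = x * y" "x \<oplus>\<^bsub>RR\<^esub> y = x + y" "\<zero>\<^bsub>RR\<^esub> = 0" "\<one>\<^bsub>RR\<^esub> = 1"
  by (simp_all add: ring_of_type_algebra_def)

lemma RR_uminus [simp]: "\<ominus>\<^bsub>RR\<^esub> x = - x"
  using RR.minus_equality[of "- x" x] by simp

lemma RR_inverse: "x \<noteq> 0 \<Longrightarrow> inv\<^bsub>RR\<^esub> x = inverse x"
  using RR.comm_inv_char[of x "inverse x"] by simp

lemma RR_pow [simp]: "x [^]\<^bsub>RR\<^esub> (n::nat) = x ^ n"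
  by (induction n) (simp_all add: RR.nat_pow_Suc)

locale real_subfield =
  fixes K :: "real set"
  assumes one [simp]: "1 \<in> K"
    and add: "\<And>x y. x \<in> K \<Longrightarrow> y \<in> K \<Longrightarrow> x + y \<in> K"
    and mult: "\<And>x y. x \<in> K \<Longrightarrow> y \<in> K \<Longrightarrow> x * y \<in> K"
    and uminus: "\<And>x. x \<in> K \<Longrightarrow> - x \<in> K"
    and inverse: "\<And>x. x \<in> K \<Longrightarrow> inverse x \<in> K"
begin

lemma zero [simp]: "0 \<in> K"
  using add[OF one uminus[OF one]] by simp

lemma diff: "x \<in> K \<Longrightarrow> y \<in> K \<Longrightarrow> x - y \<in> K"
  using add[OF _ uminus, of x y] by simp

lemma divide: "x \<in> K \<Longrightarrow> y \<in> K \<Longrightarrow> x / y \<in> K"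
  using mult[OF _ inverse, of x y] by (simp add: divide_inverse)

lemma power: "x \<in> K \<Longrightarrow> x ^ n \<in> K"
  by (induction n) (auto intro: mult)

lemma of_nat [simp]: "of_nat n \<in> K"
  by (induction n) (auto intro: add)

lemma of_int [simp]: "of_int n \<in> K"
  by (cases n) (auto intro: uminus simp del: of_nat_Suc)

lemma of_rat [simp]: "of_rat r \<in> K"
  by (cases r) (auto simp: of_rat_rat intro: divide)

lemma sum: "(\<And>i. i \<in> I \<Longrightarrow> f i \<in> K) \<Longrightarrow> sum f I \<in> K"
  by (induction I rule: infinite_finite_induct) (auto intro: add)

lemma prod: "(\<And>i. i \<in> I \<Longrightarrow> f i \<in> K) \<Longrightarrow> prod f I \<in> K"
  by (induction I rule: infinite_finite_induct) (auto intro: mult)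

lemma poly: "(\<And>i. coeff p i \<in> K) \<Longrightarrow> x \<in> K \<Longrightarrow> poly p x \<in> K"
  by (auto simp: poly_altdef intro!: sum mult power)

end

lemma subfield_imp_real_subfield:
  assumes "subfield K RR"
  shows "real_subfield K"
proof
  note K = subringE[OF subfieldE(1)[OF assms]]
  show "1 \<in> K" using K(3) by simp
  show "x + y \<in> K" if "x \<in> K" "y \<in> K" for x y using K(7)[OF that] by simp
  show "x * y \<in> K" if "x \<in> K" "y \<in> K" for x y using K(6)[OF that] by simp
  show "- x \<in> K" if "x \<in> K" for x using K(5)[OF that] by simp
  show "inverse x \<in> K" if "x \<in> K" for x
    using that RR.subfield_m_inv(1)[OF assms, of x] K(2) by (cases "x = 0") (auto simp: RR_inverse)
qed

lemma subfield_generate_field: "subfield (generate_field RR A) RR"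
  by (rule field.generate_field_is_subfield[OF field_RR]) simp

text \<open>Relative algebraic closure of Q(A) in the reals. It serves as the closure operator of a
  matroid: the dimension counts use only that it is extensive, monotone, idempotent and satisfies
  exchange.\<close>

definition acl :: "real set \<Rightarrow> real set" where
  "acl A = {r. (RR.algebraic over (generate_field RR A)) r}"

lemma subfield_acl: "subfield (acl A) RR"
  using field.subfield_of_algebraics[OF field_RR subfield_generate_field[of A]] by (simp add: acl_def)

lemma real_subfield_acl: "real_subfield (acl A)"
  by (rule subfield_imp_real_subfield[OF subfield_acl])

lemma real_subfield_generate_field: "real_subfield (generate_field RR A)"
  by (rule subfield_imp_real_subfield[OF subfield_generate_field])

lemma generate_field_subset_acl: "generate_field RR A \<subseteq> acl A"
  using RR.algebraic_self[OF subfieldE(1)[OF subfield_generate_field]] by (auto simp: acl_def)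

lemma subset_acl: "A \<subseteq> acl A"
  using generate_field_subset_acl generate_field.incl[of _ A RR] by blast

text \<open>Algebraicity is transitive: a polynomial over Q(B) has finitely many coefficients, these
  generate a finite extension \<open>F\<close> of Q(A), and r is finite over \<open>F\<close>, hence
  over Q(A).\<close>

lemma acl_subset_acl:
  assumes "B \<subseteq> acl A"
  shows "acl B \<subseteq> acl A"
proof
  fix r assume "r \<in> acl B"
  let ?K = "generate_field RR A"
  note K = subfield_generate_field[of A]
  obtain p where p: "p \<in> carrier ((generate_field RR B) [X]\<^bsub>RR\<^esub>)" "p \<noteq> []" "RR.eval p r = 0"
    using RR.algebraicE[OF subfieldE(1)[OF subfield_generate_field[of B]], of r] \<open>r \<in> acl B\<close>
    by (auto simp: acl_def)
  have "generate_field RR B \<subseteq> acl A"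
    by (rule field.generate_field_min_subfield1[OF field_RR _ subfield_acl]) (use assms in auto)
  moreover have "set p \<subseteq> generate_field RR B" "hd p \<noteq> 0"
    using p(1,2) by (auto simp: univ_poly_def polynomial_def)
  ultimately have alg: "\<And>x. x \<in> set p \<Longrightarrow> (RR.algebraic over ?K) x" and hd: "hd p \<noteq> 0"
    by (auto simp: acl_def)
  define F where "F = RR.finite_extension ?K p"
  have F: "subfield F RR" "RR.finite_dimension ?K F"
    unfolding F_def using RR.finite_extension_is_subfield[OF K _ alg]
      RR.finite_extension_finite_dimension(1)[OF K _ alg] by auto
  have "set p \<subseteq> F"
    unfolding F_def by (rule RR.finite_extension_mem[OF subfieldE(1)[OF K]]) simp
  then have "p \<in> carrier (F [X]\<^bsub>RR\<^esub>)"
    using hd by (auto simp: univ_poly_def polynomial_def)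
  then have "(RR.algebraic over F) r"
    using RR.algebraicI p by simp
  then have "RR.finite_dimension F (RR.simple_extension F r)"
    using RR.finite_dimension_simple_extension[OF F(1), of r] by simp
  then have "RR.finite_dimension ?K (RR.simple_extension F r)"
    using RR.telescopic_base_dim(1)[OF K F] by simp
  moreover have "subring (RR.simple_extension F r) RR"
    by (rule RR.simple_extension_is_subring[OF subfieldE(1)[OF F(1)]]) simp
  moreover have "r \<in> RR.simple_extension F r"
    by (rule RR.simple_extension_mem[OF subfieldE(1)[OF F(1)]]) simp
  ultimately show "r \<in> acl A"
    unfolding acl_def using RR.finite_dimension_imp_algebraic[OF K] by blast
qed

lemma acl_mono: "A \<subseteq> B \<Longrightarrow> acl A \<subseteq> acl B"
  using acl_subset_acl subset_acl by (metis order_trans)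

text \<open>HOL-Algebra lists a polynomial from the leading coefficient down, \<open>Poly\<close>
  from the constant term up.\<close>

lemma RR_eval: "RR.eval l x = poly (Poly (rev l)) x"
  by (induction l) (simp_all add: Poly_append poly_monom)

lemma acl_iff_generate_field:
  "r \<in> acl A \<longleftrightarrow> (\<exists>p. p \<noteq> 0 \<and> (\<forall>i. coeff p i \<in> generate_field RR A) \<and> poly p r = 0)"
proof
  interpret real_subfield "generate_field RR A" by (rule real_subfield_generate_field)
  assume "r \<in> acl A"
  then obtain p where p: "p \<in> carrier ((generate_field RR A) [X]\<^bsub>RR\<^esub>)" "p \<noteq> []" "RR.eval p r = 0"
    using RR.algebraicE[OF subfieldE(1)[OF subfield_generate_field[of A]], of r]
    by (auto simp: acl_def)
  have *: "set p \<subseteq> generate_field RR A" "hd p \<noteq> 0"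
    using p(1,2) by (auto simp: univ_poly_def polynomial_def)
  have "coeff (Poly (rev p)) (length p - 1) = hd p"
    using p(2) by (auto simp: coeff_Poly_eq nth_default_def rev_nth hd_conv_nth)
  then have "Poly (rev p) \<noteq> 0"
    using *(2) by (metis coeff_0)
  moreover have "coeff (Poly (rev p)) i \<in> generate_field RR A" for i
    using *(1) nth_mem[of i "rev p"] by (auto simp: coeff_Poly_eq nth_default_def)
  ultimately show "\<exists>p. p \<noteq> 0 \<and> (\<forall>i. coeff p i \<in> generate_field RR A) \<and> poly p r = 0"
    using p(3) by (auto simp: RR_eval)
next
  assume "\<exists>p. p \<noteq> 0 \<and> (\<forall>i. coeff p i \<in> generate_field RR A) \<and> poly p r = 0"
  then obtain p where p: "p \<noteq> 0" "\<And>i. coeff p i \<in> generate_field RR A" "poly p r = 0" by blast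
  let ?l = "rev (coeffs p)"
  have "set ?l \<subseteq> generate_field RR A"
    using p(2) by (auto simp: coeffs_def)
  moreover have "hd ?l \<noteq> 0"
    using p(1) by (simp add: hd_rev last_coeffs_eq_coeff_degree)
  ultimately have "?l \<in> carrier ((generate_field RR A) [X]\<^bsub>RR\<^esub>)"
    by (auto simp: univ_poly_def polynomial_def)
  then have "(RR.algebraic over (generate_field RR A)) r"
    by (rule RR.algebraicI) (use p in \<open>auto simp: RR_eval\<close>)
  then show "r \<in> acl A" by (simp add: acl_def)
qed

lemma generate_ring_subset_generate_field: "generate_ring RR A \<subseteq> generate_field RR A"
proof
  interpret real_subfield "generate_field RR A" by (rule real_subfield_generate_field)
  show "x \<in> generate_field RR A" if "x \<in> generate_ring RR A" for x
    using that by induction (auto intro: generate_field.incl add mult uminus)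
qed

lemma generate_ring_closed:
  "1 \<in> generate_ring RR A" "0 \<in> generate_ring RR A"
  "x \<in> generate_ring RR A \<Longrightarrow> - x \<in> generate_ring RR A"
  "x \<in> generate_ring RR A \<Longrightarrow> y \<in> generate_ring RR A \<Longrightarrow> x + y \<in> generate_ring RR A"
  "x \<in> generate_ring RR A \<Longrightarrow> y \<in> generate_ring RR A \<Longrightarrow> x * y \<in> generate_ring RR A"
proof -
  show one: "1 \<in> generate_ring RR A" using generate_ring.one[of RR A] by simp
  show um: "x \<in> generate_ring RR A \<Longrightarrow> - x \<in> generate_ring RR A" for x
    using generate_ring.a_inv[of x RR A] by simp
  show add: "x \<in> generate_ring RR A \<Longrightarrow> y \<in> generate_ring RR A \<Longrightarrow> x + y \<in> generate_ring RR A" for x y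
    using generate_ring.eng_add[of x RR A y] by simp
  show "x \<in> generate_ring RR A \<Longrightarrow> y \<in> generate_ring RR A \<Longrightarrow> x * y \<in> generate_ring RR A"
    using generate_ring.eng_mult[of x RR A y] by simp
  show "0 \<in> generate_ring RR A" using add[OF one um[OF one]] by simp
qed

lemma generate_ring_sum:
  "(\<And>i. i \<in> I \<Longrightarrow> f i \<in> generate_ring RR A) \<Longrightarrow> sum f I \<in> generate_ring RR A"
  by (induction I rule: infinite_finite_induct) (auto intro: generate_ring_closed)

lemma generate_ring_power: "x \<in> generate_ring RR A \<Longrightarrow> x ^ n \<in> generate_ring RR A"
  by (induction n) (auto intro: generate_ring_closed)

lemma generate_ring_mono: "A \<subseteq> B \<Longrightarrow> generate_ring RR A \<subseteq> generate_ring RR B"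
  by (rule RR.mono_generate_ring) auto

lemma generate_field_fraction:
  assumes "x \<in> generate_field RR A"
  shows "\<exists>u\<in>generate_ring RR A. \<exists>v\<in>generate_ring RR A. v \<noteq> 0 \<and> x = u / v"
  using assms
proof induction
  case one
  then show ?case by (intro bexI[of _ 1]) (auto intro: generate_ring_closed)
next
  case (incl h)
  then show ?case by (intro bexI[of _ h] bexI[of _ 1]) (auto intro: generate_ring_closed generate_ring.incl)
next
  case (a_inv h)
  then obtain u v where "u \<in> generate_ring RR A" "v \<in> generate_ring RR A" "v \<noteq> 0" "h = u / v" by blast
  then show ?case by (intro bexI[of _ "- u"] bexI[of _ v]) (auto intro: generate_ring_closed)
next
  case (m_inv h)
  then obtain u v where "u \<in> generate_ring RR A" "v \<in> generate_ring RR A" "v \<noteq> 0" "h = u / v" by blast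
  then show ?case using m_inv by (intro bexI[of _ v] bexI[of _ u]) (auto simp: RR_inverse)
next
  case (eng_add h1 h2)
  then obtain u v u' v' where "u \<in> generate_ring RR A" "v \<in> generate_ring RR A" "v \<noteq> 0" "h1 = u / v"
    "u' \<in> generate_ring RR A" "v' \<in> generate_ring RR A" "v' \<noteq> 0" "h2 = u' / v'" by blast
  then have "h1 + h2 = (u * v' + u' * v) / (v * v')" "u * v' + u' * v \<in> generate_ring RR A"
    "v * v' \<in> generate_ring RR A" "v * v' \<noteq> 0"
    by (auto intro!: generate_ring_closed simp: add_frac_eq)
  then show ?case unfolding RR_simps by blast
next
  case (eng_mult h1 h2)
  then obtain u v u' v' where "u \<in> generate_ring RR A" "v \<in> generate_ring RR A" "v \<noteq> 0" "h1 = u / v"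
    "u' \<in> generate_ring RR A" "v' \<in> generate_ring RR A" "v' \<noteq> 0" "h2 = u' / v'" by blast
  then show ?case by (intro bexI[of _ "u * u'"] bexI[of _ "v * v'"])
    (auto intro!: generate_ring_closed)
qed

lemma common_denominator:
  assumes "\<And>i. coeff p i \<in> generate_field RR A"
  shows "\<exists>d\<in>generate_ring RR A. d \<noteq> 0 \<and> (\<forall>i. coeff (smult d p) i \<in> generate_ring RR A)"
  using assms
proof (induction p)
  case 0
  then show ?case by (intro bexI[of _ 1]) (auto intro: generate_ring_closed)
next
  case (pCons c p)
  have "coeff p i \<in> generate_field RR A" for i
    using pCons.prems[of "Suc i"] by simp
  then obtain d where d: "d \<in> generate_ring RR A" "d \<noteq> 0" "\<And>i. coeff (smult d p) i \<in> generate_ring RR A"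
    using pCons.IH by blast
  obtain u v where uv: "u \<in> generate_ring RR A" "v \<in> generate_ring RR A" "v \<noteq> 0" "c = u / v"
    using generate_field_fraction[of c A] pCons.prems[of 0] by auto
  have "coeff (smult (d * v) (pCons c p)) i \<in> generate_ring RR A" for i
  proof (cases i)
    case 0
    then show ?thesis using uv d by (auto intro: generate_ring_closed)
  next
    case (Suc j)
    then have "coeff (smult (d * v) (pCons c p)) i = v * coeff (smult d p) j" by simp
    then show ?thesis using uv(2) d(3)[of j] generate_ring_closed(5) by metis
  qed
  then show ?case using uv d by (intro bexI[of _ "d * v"]) (auto intro: generate_ring_closed)
qed

text \<open>With denominators cleared, the coefficients are polynomial expressions in A, which
  \<open>pexp\<close> can describe without division.\<close>

lemma acl_iff:
  "r \<in> acl A \<longleftrightarrow> (\<exists>p. p \<noteq> 0 \<and> (\<forall>i. coeff p i \<in> generate_ring RR A) \<and> poly p r = 0)"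
proof
  assume "r \<in> acl A"
  then obtain p where p: "p \<noteq> 0" "\<And>i. coeff p i \<in> generate_field RR A" "poly p r = 0"
    unfolding acl_iff_generate_field by blast
  with common_denominator[OF p(2)] obtain d where "d \<noteq> 0" "\<And>i. coeff (smult d p) i \<in> generate_ring RR A"
    by blast
  then show "\<exists>p. p \<noteq> 0 \<and> (\<forall>i. coeff p i \<in> generate_ring RR A) \<and> poly p r = 0"
    using p by (intro exI[of _ "smult d p"]) auto
qed (use generate_ring_subset_generate_field in \<open>unfold acl_iff_generate_field, blast\<close>)

section \<open>The exchange property and independent lists\<close>

lemma generate_ring_insert:
  assumes "x \<in> generate_ring RR (insert s A)"
  shows "\<exists>q. (\<forall>i. coeff q i \<in> generate_ring RR A) \<and> x = poly q s"
  using assms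
proof induction
  case one
  then show ?case by (intro exI[of _ 1]) (auto intro: generate_ring_closed)
next
  case (incl h)
  show ?case
  proof (cases "h = s")
    case True
    then show ?thesis by (intro exI[of _ "[:0, 1:]"])
      (auto simp: coeff_pCons intro: generate_ring_closed split: nat.splits)
  next
    case False
    then show ?thesis using incl by (intro exI[of _ "[:h:]"])
      (auto simp: coeff_pCons intro: generate_ring_closed generate_ring.incl split: nat.splits)
  qed
next
  case (a_inv h)
  then obtain q where "\<And>i. coeff q i \<in> generate_ring RR A" "h = poly q s" by blast
  then show ?case by (intro exI[of _ "- q"]) (auto intro: generate_ring_closed)
next
  case (eng_add h1 h2)
  then obtain q q' where "\<And>i. coeff q i \<in> generate_ring RR A" "h1 = poly q s"
    "\<And>i. coeff q' i \<in> generate_ring RR A" "h2 = poly q' s" by blast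
  then show ?case by (intro exI[of _ "q + q'"]) (auto intro: generate_ring_closed)
next
  case (eng_mult h1 h2)
  then obtain q q' where "\<And>i. coeff q i \<in> generate_ring RR A" "h1 = poly q s"
    "\<And>i. coeff q' i \<in> generate_ring RR A" "h2 = poly q' s" by blast
  then show ?case
    by (intro exI[of _ "q * q'"]) (auto simp: coeff_mult intro!: generate_ring_closed generate_ring_sum)
qed

text \<open>A relation for r over Z[A][s] is a polynomial in two variables that vanishes at (r, s);
  read in the other variable, it is a relation for s over Z[A][r]. It does not become trivial,
  because r is transcendental over Q(A).\<close>

lemma acl_exchange:
  assumes "r \<in> acl (insert s A)" "r \<notin> acl A"
  shows "s \<in> acl (insert r A)"
proof -
  obtain p where p: "p \<noteq> 0" "\<And>i. coeff p i \<in> generate_ring RR (insert s A)" "poly p r = 0"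
    using assms(1) unfolding acl_iff by blast
  define d where "d = Polynomial.degree p"
  obtain q where q: "\<And>i j. coeff (q i) j \<in> generate_ring RR A" "\<And>i. coeff p i = poly (q i) s"
    using generate_ring_insert[OF p(2)] by metis
  define R where "R = (\<Sum>i\<le>d. smult (r ^ i) (q i))"
  have "poly R s = 0"
    using p(3) by (simp add: R_def poly_sum poly_altdef[of p] flip: q(2) d_def) (simp add: mult.commute)
  moreover have "coeff R j \<in> generate_ring RR (insert r A)" for j
  proof -
    have "coeff (q i) j \<in> generate_ring RR (insert r A)" for i
      using q(1)[of i j] generate_ring_mono[of A "insert r A"] by blast
    moreover have "r \<in> generate_ring RR (insert r A)"
      by (simp add: generate_ring.incl)
    ultimately show ?thesis
      by (auto simp: R_def coeff_sum intro!: generate_ring_sum generate_ring_closed generate_ring_power)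
  qed
  moreover have "R \<noteq> 0"
  proof
    assume "R = 0"
    have "coeff (q i) j = 0" if "i \<le> d" for i j
    proof (rule ccontr)
      assume nz: "coeff (q i) j \<noteq> 0"
      \<comment> \<open>\<open>T\<close> collects the coefficients of s^j into a polynomial over
        Z[A] in the other variable; a nonzero \<open>T\<close> with root r contradicts
        \<open>r \<notin> acl A\<close>.\<close>
      define T where "T = (\<Sum>i\<le>d. Polynomial.monom (coeff (q i) j) i)"
      have "poly T r = coeff R j"
        by (simp add: T_def R_def poly_sum poly_monom coeff_sum mult.commute)
      moreover have cT: "coeff T l = (if l \<le> d then coeff (q l) j else 0)" for l
        by (simp add: T_def coeff_sum sum.delta)
      moreover have "T \<noteq> 0"
        using cT[of i] nz that by auto
      ultimately have "poly T r = 0" "T \<noteq> 0" "\<And>l. coeff T l \<in> generate_ring RR A"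
        using \<open>R = 0\<close> q(1) by (auto intro: generate_ring_closed)
      then show False using assms(2) unfolding acl_iff by blast
    qed
    then have "coeff p d = 0"
      by (simp add: q(2) poly_altdef)
    then show False using p(1) by (simp add: d_def)
  qed
  ultimately show ?thesis unfolding acl_iff by blast
qed

text \<open>Independence is tested one entry at a time over a growing base. A successive generic
  choice produces it in this form, and the induction in \<open>steinitz_acl\<close> consumes it in
  this form.\<close>

fun indep_list :: "real set \<Rightarrow> real list \<Rightarrow> bool" where
  "indep_list D [] \<longleftrightarrow> True"
| "indep_list D (b # bs) \<longleftrightarrow> b \<notin> acl D \<and> indep_list (insert b D) bs"

lemma indep_list_distinct: "indep_list D bs \<Longrightarrow> distinct bs \<and> set bs \<inter> D = {}"
proof (induction bs arbitrary: D)
  case (Cons b bs)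
  then show ?case using subset_acl[of D] by auto
qed simp

lemma indep_list_snoc: "indep_list D (bs @ [b]) \<longleftrightarrow> indep_list D bs \<and> b \<notin> acl (D \<union> set bs)"
  by (induction bs arbitrary: D) auto

text \<open>When the elements of Y are added to D one at a time, there is a first one that makes b
  algebraic; that element can be exchanged for b.\<close>

lemma acl_exchange_finite:
  assumes "finite Y" "b \<in> acl (D \<union> Y)" "b \<notin> acl D"
  shows "\<exists>y\<in>Y. y \<in> acl (insert b D \<union> (Y - {y}))"
  using assms
proof (induction Y)
  case (insert z Y)
  show ?case
  proof (cases "b \<in> acl (D \<union> Y)")
    case True
    then obtain y where y: "y \<in> Y" "y \<in> acl (insert b D \<union> (Y - {y}))"
      using insert by blast
    have "insert b D \<union> (Y - {y}) \<subseteq> insert b D \<union> (insert z Y - {y})" by auto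
    then show ?thesis using y acl_mono by blast
  next
    case False
    have "b \<in> acl (insert z (D \<union> Y))"
      using insert.prems(1) by simp
    then have "z \<in> acl (insert b (D \<union> Y))"
      using False by (rule acl_exchange)
    moreover have "insert b (D \<union> Y) = insert b D \<union> (insert z Y - {z})"
      using insert.hyps by auto
    ultimately show ?thesis by auto
  qed
qed auto

text \<open>Each entry of \<open>bs\<close> moves into \<open>D\<close> in exchange for one element
  of \<open>Y\<close>, and the closure does not shrink; so \<open>Y\<close> cannot run out before
  \<open>bs\<close> does.\<close>

theorem steinitz_acl:
  assumes "finite Y" "indep_list D bs" "set bs \<subseteq> acl (D \<union> Y)"
  shows "length bs \<le> card Y"
  using assms
proof (induction bs arbitrary: D Y)
  case (Cons b bs)
  obtain y where y: "y \<in> Y" "y \<in> acl (insert b D \<union> (Y - {y}))"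
    using acl_exchange_finite[of Y b D] Cons.prems by auto
  have "D \<union> Y \<subseteq> acl (insert b D \<union> (Y - {y}))"
    using y subset_acl[of "insert b D \<union> (Y - {y})"] by auto
  then have "acl (D \<union> Y) \<subseteq> acl (insert b D \<union> (Y - {y}))"
    by (rule acl_subset_acl)
  then have "length bs \<le> card (Y - {y})"
    using Cons.prems by (intro Cons.IH[of _ "insert b D"]) auto
  moreover have "Suc (card (Y - {y})) = card Y"
    using y(1) Cons.prems(1) by (rule card_Suc_Diff1[rotated])
  ultimately show ?case by simp
qed simp

lemma exists_acl_basis:
  "\<exists>bs. set bs \<subseteq> set ys \<and> indep_list D bs \<and> set ys \<subseteq> acl (D \<union> set bs)"
proof (induction ys rule: rev_induct)
  case (snoc y ys)
  then obtain bs where bs: "set bs \<subseteq> set ys" "indep_list D bs" "set ys \<subseteq> acl (D \<union> set bs)"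
    by blast
  show ?case
  proof (cases "y \<in> acl (D \<union> set bs)")
    case True
    then show ?thesis using bs by (intro exI[of _ bs]) auto
  next
    case False
    moreover have "acl (D \<union> set bs) \<subseteq> acl (D \<union> set (bs @ [y]))" by (rule acl_mono) auto
    moreover have "y \<in> acl (D \<union> set (bs @ [y]))" using subset_acl by force
    ultimately show ?thesis using bs
      by (intro exI[of _ "bs @ [y]"]) (auto simp: indep_list_snoc)
  qed
qed auto

text \<open>
  A countable syntax for the polynomials in the \<open>y v\<close> with coefficients in \<open>\<int>[d 0, d 1, \<dots>]\<close>.
\<close>

datatype pexp = POne | PCst nat | PVar nat | PNeg pexp | PAdd pexp pexp | PMul pexp pexp

instance pexp :: countable
  by countable_datatype

primrec peval :: "(nat \<Rightarrow> real) \<Rightarrow> pexp \<Rightarrow> (nat \<Rightarrow> real) \<Rightarrow> real" where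
  "peval d POne y = 1"
| "peval d (PCst i) y = d i"
| "peval d (PVar v) y = y v"
| "peval d (PNeg e) y = - peval d e y"
| "peval d (PAdd e e') y = peval d e y + peval d e' y"
| "peval d (PMul e e') y = peval d e y * peval d e' y"

primrec pvars :: "pexp \<Rightarrow> nat set" where
  "pvars POne = {}"
| "pvars (PCst i) = {}"
| "pvars (PVar v) = {v}"
| "pvars (PNeg e) = pvars e"
| "pvars (PAdd e e') = pvars e \<union> pvars e'"
| "pvars (PMul e e') = pvars e \<union> pvars e'"

lemma peval_in_generate_ring:
  "pvars e \<subseteq> J \<Longrightarrow> peval d e y \<in> generate_ring RR (range d \<union> y ` J)"
  by (induction e) (auto intro!: generate_ring_closed intro: generate_ring.incl)

lemma generate_ring_imp_peval:
  assumes "x \<in> generate_ring RR (range d \<union> y ` J)"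
  shows "\<exists>e. pvars e \<subseteq> J \<and> x = peval d e y"
  using assms
proof induction
  case one
  show ?case by (rule exI[of _ POne]) simp
next
  case (incl h)
  then consider i where "h = d i" | v where "v \<in> J" "h = y v" by blast
  then show ?case
  proof cases
    case (1 i) then show ?thesis by (intro exI[of _ "PCst i"]) simp
  next
    case (2 v) then show ?thesis by (intro exI[of _ "PVar v"]) simp
  qed
next
  case (a_inv h)
  then obtain e where "pvars e \<subseteq> J" "h = peval d e y" by blast
  then show ?case by (intro exI[of _ "PNeg e"]) simp
next
  case (eng_add h h')
  then obtain e e' where "pvars e \<subseteq> J" "h = peval d e y" "pvars e' \<subseteq> J" "h' = peval d e' y" by blast
  then show ?case by (intro exI[of _ "PAdd e e'"]) simp
next
  case (eng_mult h h')
  then obtain e e' where "pvars e \<subseteq> J" "h = peval d e y" "pvars e' \<subseteq> J" "h' = peval d e' y" by blast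
  then show ?case by (intro exI[of _ "PMul e e'"]) simp
qed

section \<open>Countability and generic choices\<close>

lemma countable_generate_ring:
  assumes "countable A"
  shows "countable (generate_ring RR A)"
proof -
  \<comment> \<open>\<open>from_nat_into\<close> enumerates nonempty sets only, hence the additional
    0.\<close>
  define d where "d = from_nat_into (insert 0 A)"
  have d: "range d = insert 0 A"
    unfolding d_def using assms by (intro range_from_nat_into) auto
  have "generate_ring RR A \<subseteq> generate_ring RR (insert 0 A)"
    by (rule generate_ring_mono) auto
  also have "\<dots> \<subseteq> range (\<lambda>e. peval d e (\<lambda>_. 0))"
    using generate_ring_imp_peval[of _ d "\<lambda>_. 0" "{}"] by (auto simp: d)
  finally show ?thesis
    by (rule countable_subset) (rule countable_image, simp)
qed

text \<open>There are countably many polynomials, with finitely many roots each. Hence every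
  interval contains numbers transcendental over a given countable set.\<close>

lemma countable_acl:
  assumes "countable A"
  shows "countable (acl A)"
proof -
  let ?R = "generate_ring RR A"
  have "acl A \<subseteq> (\<Union>p\<in>Poly ` lists ?R. if p = 0 then {} else {r. poly p r = 0})"
  proof
    fix r assume "r \<in> acl A"
    then obtain p where p: "p \<noteq> 0" "\<And>i. coeff p i \<in> ?R" "poly p r = 0"
      unfolding acl_iff by blast
    then have "coeffs p \<in> lists ?R" by (auto simp: coeffs_def)
    then have "p \<in> Poly ` lists ?R" by (metis Poly_coeffs imageI)
    then show "r \<in> (\<Union>p\<in>Poly ` lists ?R. if p = 0 then {} else {r. poly p r = 0})"
      using p by auto
  qed
  moreover have "countable (\<Union>p\<in>Poly ` lists ?R. if p = 0 then {} else {r. poly p r = 0})"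
    using countable_generate_ring[OF assms]
    by (intro countable_UN countable_image countable_lists)
       (auto intro: countable_finite simp: poly_roots_finite)
  ultimately show ?thesis by (rule countable_subset)
qed

lemma exists_indep_in_intervals:
  assumes "countable D" "\<And>i. l i < u i"
  shows "\<exists>c. (\<forall>i<M. l i < c i \<and> c i < u i) \<and> indep_list D (map c [0..<M])"
proof (induction M)
  case (Suc M)
  then obtain c where c: "\<And>i. i < M \<Longrightarrow> l i < c i \<and> c i < u i" "indep_list D (map c [0..<M])" by blast
  have "countable (acl (D \<union> set (map c [0..<M])))"
    using assms(1) by (intro countable_acl) (simp add: countable_finite)
  then have "\<not> {l M<..<u M} \<subseteq> acl (D \<union> set (map c [0..<M]))"
    using assms(2)[of M] uncountable_open_interval countable_subset by metis
  then obtain b where b: "l M < b" "b < u M" "b \<notin> acl (D \<union> set (map c [0..<M]))"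
    by (metis greaterThanLessThan_iff subsetI)
  have "map (c(M := b)) [0..<Suc M] = map c [0..<M] @ [b]" by auto
  then have "indep_list D (map (c(M := b)) [0..<Suc M])"
    using c b by (simp only: indep_list_snoc simp_thms)
  moreover have "\<forall>i<Suc M. l i < (c(M := b)) i \<and> (c(M := b)) i < u i"
    using c b by (auto simp: less_Suc_eq)
  ultimately show ?case by blast
qed auto

section \<open>From independent lists to \<open>trdeg_tuple\<close>\<close>

lemma rat_poly_eval_in_generate_field:
  assumes "\<And>m. m \<in> Poly_Mapping.keys P \<Longrightarrow> Poly_Mapping.keys m \<subseteq> B"
  shows "rat_poly_eval P \<in> generate_field RR B"
proof -
  interpret real_subfield "generate_field RR B" by (rule real_subfield_generate_field)
  show ?thesis
    unfolding rat_poly_eval_def using assms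
    by (intro sum mult of_rat prod power) (auto intro: generate_field.incl)
qed

text \<open>A relation on \<open>insert b B\<close>, grouped by powers of b, is a polynomial in b
  with coefficients in Q[B]. As b is transcendental over Q(B), all these coefficients are 0, and the
  independence of B makes each of them the zero polynomial.\<close>

lemma alg_indep_insert:
  assumes B: "alg_indep_over_Rats B" and b: "b \<notin> acl B"
  shows "alg_indep_over_Rats (insert b B)"
  unfolding alg_indep_over_Rats_def
proof (intro allI impI)
  fix P :: "(real \<Rightarrow>\<^sub>0 nat) \<Rightarrow>\<^sub>0 rat"
  assume P: "(\<forall>m\<in>Poly_Mapping.keys P. Poly_Mapping.keys m \<subseteq> insert b B) \<and> rat_poly_eval P = 0"
  have bB: "b \<notin> B" using b subset_acl by blast
  let ?up = "\<lambda>n m. Poly_Mapping.update b n (m :: real \<Rightarrow>\<^sub>0 nat)"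
  define mon where "mon m = (\<Prod>z\<in>Poly_Mapping.keys m. z ^ Poly_Mapping.lookup m z)" for m :: "real \<Rightarrow>\<^sub>0 nat"
  have upup: "?up n (?up k m) = ?up n m" for n k m
    by (rule poly_mapping_eqI) (simp add: lookup_update)
  have upid: "?up (Poly_Mapping.lookup m b) m = m" for m
    by (rule poly_mapping_eqI) (simp add: lookup_update)
  have keys_up: "Poly_Mapping.keys (?up 0 m) = Poly_Mapping.keys m - {b}" for m
    by (auto simp: in_keys_iff lookup_update split: if_splits)
  \<comment> \<open>\<open>Q n\<close> is the coefficient of b^n: a monomial m without b receives
    the coefficient that \<open>P\<close> gives to m times b^n.\<close>
  define Q where "Q n = Poly_Mapping.Abs_poly_mapping
    (\<lambda>m. if b \<in> Poly_Mapping.keys m then 0 else Poly_Mapping.lookup P (?up n m))" for n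
  have Q: "Poly_Mapping.lookup (Q n) m =
      (if b \<in> Poly_Mapping.keys m then 0 else Poly_Mapping.lookup P (?up n m))" for n m
  proof -
    have "{m. (if b \<in> Poly_Mapping.keys m then 0 else Poly_Mapping.lookup P (?up n m)) \<noteq> 0}
        \<subseteq> ?up 0 ` Poly_Mapping.keys P"
    proof
      fix m assume "m \<in> {m. (if b \<in> Poly_Mapping.keys m then 0 else Poly_Mapping.lookup P (?up n m)) \<noteq> 0}"
      then have m: "b \<notin> Poly_Mapping.keys m" "?up n m \<in> Poly_Mapping.keys P"
        by (auto simp: in_keys_iff split: if_splits)
      then have "m = ?up 0 (?up n m)"
        using upid[of m] by (simp add: upup in_keys_iff)
      then show "m \<in> ?up 0 ` Poly_Mapping.keys P" using m by blast
    qed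
    then have "finite {m. (if b \<in> Poly_Mapping.keys m then 0 else Poly_Mapping.lookup P (?up n m)) \<noteq> 0}"
      by (rule finite_subset) simp
    then show ?thesis unfolding Q_def by (simp add: lookup_Abs_poly_mapping)
  qed
  have keysQ: "Poly_Mapping.keys (Q n) = ?up 0 ` {m \<in> Poly_Mapping.keys P. Poly_Mapping.lookup m b = n}" for n
  proof (intro equalityI subsetI)
    fix m assume "m \<in> Poly_Mapping.keys (Q n)"
    then have m: "b \<notin> Poly_Mapping.keys m" "?up n m \<in> Poly_Mapping.keys P"
      by (auto simp: in_keys_iff Q split: if_splits)
    then have "m = ?up 0 (?up n m)"
      using upid[of m] by (simp add: upup in_keys_iff)
    moreover have "Poly_Mapping.lookup (?up n m) b = n" by (simp add: lookup_update)
    ultimately show "m \<in> ?up 0 ` {m \<in> Poly_Mapping.keys P. Poly_Mapping.lookup m b = n}"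
      using m by blast
  next
    fix m assume "m \<in> ?up 0 ` {m \<in> Poly_Mapping.keys P. Poly_Mapping.lookup m b = n}"
    then obtain m' where m': "m = ?up 0 m'" "m' \<in> Poly_Mapping.keys P" "Poly_Mapping.lookup m' b = n" by blast
    then show "m \<in> Poly_Mapping.keys (Q n)"
      using upid[of m'] by (auto simp: in_keys_iff Q keys_up upup lookup_update)
  qed
  have evalQ: "rat_poly_eval (Q n) * b ^ n =
      (\<Sum>m\<in>{m \<in> Poly_Mapping.keys P. Poly_Mapping.lookup m b = n}. of_rat (Poly_Mapping.lookup P m) * mon m)" for n
  proof -
    have inj: "inj_on (?up 0) {m \<in> Poly_Mapping.keys P. Poly_Mapping.lookup m b = n}"
    proof (rule inj_onI)
      fix m m' assume m: "m \<in> {m \<in> Poly_Mapping.keys P. Poly_Mapping.lookup m b = n}"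
        "m' \<in> {m \<in> Poly_Mapping.keys P. Poly_Mapping.lookup m b = n}" "?up 0 m = ?up 0 m'"
      have "m = ?up n (?up 0 m)" using m(1) upid[of m] by (simp only: upup mem_Collect_eq)
      also have "\<dots> = m'" using m(2) upid[of m'] by (simp only: m(3) upup mem_Collect_eq)
      finally show "m = m'" .
    qed
    have mon: "mon m = mon (?up 0 m) * b ^ Poly_Mapping.lookup m b" for m
    proof -
      have 1: "mon (?up 0 m) = (\<Prod>z\<in>Poly_Mapping.keys m - {b}. z ^ Poly_Mapping.lookup m z)"
        unfolding mon_def keys_up by (rule prod.cong) (auto simp: lookup_update)
      show ?thesis
      proof (cases "b \<in> Poly_Mapping.keys m")
        case True
        then show ?thesis unfolding 1 unfolding mon_def by (subst prod.remove[of _ b]) auto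
      next
        case False
        then show ?thesis unfolding 1 unfolding mon_def by (simp add: in_keys_iff)
      qed
    qed
    have "rat_poly_eval (Q n) * b ^ n =
       (\<Sum>m\<in>{m \<in> Poly_Mapping.keys P. Poly_Mapping.lookup m b = n}.
          of_rat (Poly_Mapping.lookup (Q n) (?up 0 m)) * mon (?up 0 m)) * b ^ n"
      unfolding rat_poly_eval_def keysQ mon_def by (subst sum.reindex[OF inj]) simp
    also have "\<dots> = (\<Sum>m\<in>{m \<in> Poly_Mapping.keys P. Poly_Mapping.lookup m b = n}. of_rat (Poly_Mapping.lookup P m) * mon m)"
      unfolding sum_distrib_right
    proof (rule sum.cong)
      fix m assume m: "m \<in> {m \<in> Poly_Mapping.keys P. Poly_Mapping.lookup m b = n}"
      have "Poly_Mapping.lookup (Q n) (?up 0 m) = Poly_Mapping.lookup P m"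
        using m upid[of m] by (simp add: Q keys_up upup)
      then show "of_rat (Poly_Mapping.lookup (Q n) (?up 0 m)) * mon (?up 0 m) * b ^ n =
          of_rat (Poly_Mapping.lookup P m) * mon m"
        using m mon[of m] by simp
    qed simp
    finally show ?thesis .
  qed
  define N where "N = (\<lambda>m. Poly_Mapping.lookup m b) ` Poly_Mapping.keys P"
  have finN: "finite N" by (simp add: N_def)
  have sum0: "(\<Sum>n\<in>N. rat_poly_eval (Q n) * b ^ n) = 0"
  proof -
    have "(\<Sum>n\<in>N. rat_poly_eval (Q n) * b ^ n) =
       (\<Sum>m\<in>Poly_Mapping.keys P. of_rat (Poly_Mapping.lookup P m) * mon m)"
      unfolding evalQ N_def by (rule sum.group) auto
    then show ?thesis using P by (simp add: rat_poly_eval_def mon_def)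
  qed
  have kQ: "\<And>n m. m \<in> Poly_Mapping.keys (Q n) \<Longrightarrow> Poly_Mapping.keys m \<subseteq> B"
    using P by (fastforce simp: keysQ keys_up)
  define T where "T = (\<Sum>n\<in>N. Polynomial.monom (rat_poly_eval (Q n)) n)"
  have cT: "coeff T n = (if n \<in> N then rat_poly_eval (Q n) else 0)" for n
    using finN by (simp add: T_def coeff_sum sum.delta)
  interpret K: real_subfield "generate_field RR B" by (rule real_subfield_generate_field)
  have "poly T b = 0"
    using sum0 by (simp add: T_def poly_sum poly_monom)
  moreover have "coeff T n \<in> generate_field RR B" for n
    using rat_poly_eval_in_generate_field[OF kQ] by (simp add: cT)
  ultimately have "T = 0"
    using b unfolding acl_iff_generate_field by blast
  then have "rat_poly_eval (Q n) = 0" if "n \<in> N" for n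
    using cT[of n] that by simp
  then have Q0: "Q n = 0" if "n \<in> N" for n
    using B kQ that unfolding alg_indep_over_Rats_def by blast
  show "P = 0"
  proof (rule ccontr)
    assume "P \<noteq> 0"
    then obtain m where m: "m \<in> Poly_Mapping.keys P" by (metis keys_eq_empty all_not_in_conv)
    then have "?up 0 m \<in> Poly_Mapping.keys (Q (Poly_Mapping.lookup m b))"
      by (auto simp: keysQ)
    moreover have "Poly_Mapping.lookup m b \<in> N" using m by (simp add: N_def)
    ultimately show False using Q0 by simp
  qed
qed

lemma alg_indep_empty: "alg_indep_over_Rats {}"
  unfolding alg_indep_over_Rats_def
proof (intro allI impI)
  fix P :: "(real \<Rightarrow>\<^sub>0 nat) \<Rightarrow>\<^sub>0 rat"
  assume P: "(\<forall>m\<in>Poly_Mapping.keys P. Poly_Mapping.keys m \<subseteq> {}) \<and> rat_poly_eval P = 0"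
  then have "Poly_Mapping.keys P \<subseteq> {0}" by auto
  then consider "Poly_Mapping.keys P = {}" | "Poly_Mapping.keys P = {0}" by blast
  then show "P = 0"
  proof cases
    case 2
    then show ?thesis using P by (auto simp: rat_poly_eval_def in_keys_iff)
  qed simp
qed

lemma alg_indep_indep_list:
  "indep_list D bs \<Longrightarrow> B \<subseteq> D \<Longrightarrow> alg_indep_over_Rats B \<Longrightarrow> alg_indep_over_Rats (B \<union> set bs)"
proof (induction bs arbitrary: B D)
  case (Cons b bs)
  then have "alg_indep_over_Rats (insert b B)"
    using acl_mono[of B D] by (intro alg_indep_insert) auto
  then show ?case
    using Cons.IH[of "insert b D" "insert b B"] Cons.prems by auto
qed simp

text \<open>Independence over any base \<open>D\<close> implies independence over the rationals, so
  a lower bound obtained over Q(S) passes to \<open>trdeg_tuple\<close>.\<close>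

lemma length_le_trdeg_tuple:
  assumes "indep_list D bs" "set bs \<subseteq> set ts"
  shows "enat (length bs) \<le> trdeg_tuple ts"
proof -
  have "alg_indep_over_Rats (set bs)"
    using alg_indep_indep_list[OF assms(1) _ alg_indep_empty] by simp
  moreover have "set bs \<subseteq> generate_field RR (set ts)"
    using assms(2) by (auto intro: generate_field.incl)
  moreover have "card (set bs) = length bs"
    using indep_list_distinct[OF assms(1)] distinct_card by blast
  ultimately show ?thesis
    unfolding trdeg_tuple_def trdeg_over_Rats_def
    by (intro SUP_upper2[of "set bs"]) auto
qed

section \<open>Hermite interpolation over a subfield\<close>

lemma pderiv_funpow_linear_mult:
  fixes p :: "real poly"
  shows "(pderiv ^^ q) ([:- z, 1:] * p) = [:- z, 1:] * (pderiv ^^ q) p + smult (of_nat q) ((pderiv ^^ (q - 1)) p)"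
proof (induction q)
  case (Suc q)
  show ?case
  proof (cases q)
    case 0
    then show ?thesis by (simp add: pderiv_mult pderiv_pCons del: mult_pCons_left)
  next
    case (Suc r)
    have "(pderiv ^^ Suc q) ([:- z, 1:] * p) =
        pderiv ([:- z, 1:] * (pderiv ^^ q) p + smult (of_nat q) ((pderiv ^^ (q - 1)) p))"
      using Suc.IH by simp
    also have "\<dots> = [:- z, 1:] * (pderiv ^^ Suc q) p + (pderiv ^^ q) p + smult (of_nat q) ((pderiv ^^ q) p)"
      using Suc by (simp add: pderiv_add pderiv_mult pderiv_smult pderiv_pCons del: mult_pCons_left)
    also have "\<dots> = [:- z, 1:] * (pderiv ^^ Suc q) p + smult (of_nat (Suc q)) ((pderiv ^^ (Suc q - 1)) p)"
      by (simp add: smult_add_left)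
    finally show ?thesis .
  qed
qed simp

lemma pderiv_funpow_const: "(pderiv ^^ q) [:c:] = (if q = 0 then [:c :: real:] else 0)"
  by (induction q) (auto simp: pderiv_pCons)

text \<open>Induction on the total multiplicity: in Q = (X - z) Q1 + Q(z) the quotient has one
  multiplicity less at z, and its Hermite data are rational expressions in the nodes and the data of
  Q.\<close>

lemma (in real_subfield) hermite_coeff_mem:
  assumes "finite Z" "Z \<subseteq> K"
    and "\<And>i. i \<ge> (\<Sum>z\<in>Z. \<mu> z) \<Longrightarrow> coeff Q i = 0"
    and "\<And>z q. z \<in> Z \<Longrightarrow> q < \<mu> z \<Longrightarrow> poly ((pderiv ^^ q) Q) z \<in> K"
  shows "coeff Q i \<in> K"
  using assms(3,4)
proof (induction "\<Sum>z\<in>Z. \<mu> z" arbitrary: Q \<mu> i)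
  case 0
  then show ?case by simp
next
  case (Suc S)
  then obtain z where z: "z \<in> Z" "\<mu> z > 0"
    by (metis (no_types, lifting) Zero_not_Suc bot_nat_0.not_eq_extremum sum.neutral)
  define Q1 where "Q1 = synthetic_div Q z"
  define \<mu>' where "\<mu>' = \<mu>(z := \<mu> z - 1)"
  have Q: "Q = [:- z, 1:] * Q1 + [:poly Q z:]"
    unfolding Q1_def by (rule synthetic_div_correct'[symmetric])
  have Qz: "poly Q z \<in> K" using Suc.prems(2)[of z 0] z by simp
  have "(\<Sum>z\<in>Z. \<mu> z) = \<mu> z + (\<Sum>z\<in>Z - {z}. \<mu> z)" "(\<Sum>z\<in>Z. \<mu>' z) = \<mu>' z + (\<Sum>z\<in>Z - {z}. \<mu>' z)"
    using z assms(1) by (simp_all add: sum.remove)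
  moreover have "(\<Sum>z\<in>Z - {z}. \<mu>' z) = (\<Sum>z\<in>Z - {z}. \<mu> z)"
    by (rule sum.cong) (auto simp: \<mu>'_def)
  ultimately have S: "S = (\<Sum>z\<in>Z. \<mu>' z)"
    using Suc.hyps(2) z by (simp add: \<mu>'_def)
  have "coeff Q1 i \<in> K" for i
  proof (rule Suc.hyps(1)[OF S])
    fix i assume i: "(\<Sum>z\<in>Z. \<mu>' z) \<le> i"
    have dQ: "Polynomial.degree Q \<le> S"
      using Suc.prems(1) Suc.hyps(2) by (intro degree_le) auto
    show "coeff Q1 i = 0"
    proof (cases "Polynomial.degree Q = 0")
      case True
      then show ?thesis by (simp add: Q1_def synthetic_div_eq_0_iff[THEN iffD2])
    next
      case False
      then show ?thesis
        using i S dQ by (intro coeff_eq_0) (simp add: Q1_def degree_synthetic_div)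
    qed
  next
    fix w q assume w: "w \<in> Z" "q < \<mu>' w"
    \<comment> \<open>Leibniz rule with the factor X - z, whose derivatives beyond the first vanish.
      At r = 0 the truncated \<open>r - 1\<close> is multiplied by 0.\<close>
    have D: "poly ((pderiv ^^ r) Q) w = (w - z) * poly ((pderiv ^^ r) Q1) w
        + of_nat r * poly ((pderiv ^^ (r - 1)) Q1) w + (if r = 0 then poly Q z else 0)" for r
      by (subst Q, subst higher_pderiv_add, subst pderiv_funpow_linear_mult)
         (simp add: pderiv_funpow_const algebra_simps)
    show "poly ((pderiv ^^ q) Q1) w \<in> K"
    \<comment> \<open>At z the factor w - z vanishes, so order q of \<open>Q1\<close> comes from
      order q + 1 of Q; this uses up one multiplicity. At the other nodes one divides by w - z,
      recursively in q.\<close>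
    proof (cases "w = z")
      case True
      then have "poly ((pderiv ^^ Suc q) Q) z = of_nat (Suc q) * poly ((pderiv ^^ q) Q1) z"
        using D[of "Suc q"] by simp
      moreover have "poly ((pderiv ^^ Suc q) Q) z \<in> K"
        using Suc.prems(2)[of z "Suc q"] z w True by (simp add: \<mu>'_def)
      ultimately show ?thesis
        using divide[of "poly ((pderiv ^^ Suc q) Q) z" "of_nat (Suc q)"] True
        by (simp del: of_nat_Suc funpow.simps)
    next
      case False
      then have "\<mu>' w = \<mu> w" by (simp add: \<mu>'_def)
      from w(2)[unfolded this] show ?thesis
      proof (induction q)
        case 0
        have "poly Q1 w = (poly Q w - poly Q z) / (w - z)"
          using D[of 0] False by (simp add: field_simps)
        moreover have "poly Q w \<in> K" using Suc.prems(2)[of w 0] w(1) 0 by simp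
        ultimately show ?case
          using w(1) z(1) assms(2) Qz by (auto intro!: divide diff)
      next
        case (Suc q)
        have "poly ((pderiv ^^ Suc q) Q1) w =
            (poly ((pderiv ^^ Suc q) Q) w - of_nat (Suc q) * poly ((pderiv ^^ q) Q1) w) / (w - z)"
          using D[of "Suc q"] False by (simp add: field_simps)
        moreover have "poly ((pderiv ^^ Suc q) Q) w \<in> K"
          using Suc.prems w(1) \<open>\<And>z q. z \<in> Z \<Longrightarrow> q < \<mu> z \<Longrightarrow> poly ((pderiv ^^ q) Q) z \<in> K\<close> by blast
        moreover have "poly ((pderiv ^^ q) Q1) w \<in> K" using Suc by simp
        moreover have "w \<in> K" "z \<in> K" using w(1) z(1) assms(2) by auto
        ultimately show ?case
          by (simp only: divide diff mult of_nat)
      qed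
    qed
  qed
  note Q1 = this
  show ?case
  proof (subst Q, cases i)
    case 0
    then show "coeff ([:- z, 1:] * Q1 + [:poly Q z:]) i \<in> K"
      using Q1[of 0] Qz z(1) assms(2) by (auto intro!: add mult uminus diff)
  next
    case (Suc j)
    then show "coeff ([:- z, 1:] * Q1 + [:poly Q z:]) i \<in> K"
      using Q1[of j] Q1[of i] z(1) assms(2) by (auto intro!: add mult uminus diff)
  qed
qed

subsection \<open>Spline series\<close>

text \<open>The q-th derivative of t^r / r!. In this normalisation differentiation only raises q,
  and the coefficients of a series remain the same.\<close>

definition tpw :: "nat \<Rightarrow> nat \<Rightarrow> real \<Rightarrow> real" where
  "tpw r q t = (if q \<le> r then t ^ (r - q) / fact (r - q) else 0)"

lemma tpw_has_derivative: "(tpw r q has_real_derivative tpw r (Suc q) t) (at t)"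
proof -
  consider "q < r" | "q = r" | "q > r" by linarith
  then show ?thesis
  proof cases
    case 1
    then obtain n where n: "r - q = Suc n" "r - Suc q = n" by (metis Suc_diff_Suc)
    have "((\<lambda>t. t ^ Suc n / fact (Suc n)) has_real_derivative t ^ n / fact n) (at t)"
      by (rule derivative_eq_intros refl | simp)+
    then show ?thesis using 1 n by (simp add: tpw_def[abs_def])
  qed (simp_all add: tpw_def[abs_def])
qed

lemma tpw_0: "tpw r q 0 = (if q = r then 1 else 0)"
  by (simp add: tpw_def power_0_left)

text \<open>The maximum of 2^n / n! is 2, attained at n = 1 and n = 2. Two points of (-1,1) are less
  than 2 apart, whence the bound 2 for all derivatives of all basis functions.\<close>

lemma two_power_le_fact: "(2::real) ^ n \<le> 2 * fact n"
proof (induction n)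
  case (Suc n)
  show ?case
  proof (cases n)
    case (Suc k)
    have "(2::real) ^ Suc n \<le> 2 * (2 * fact n)" using Suc.IH by simp
    also have "\<dots> \<le> real (Suc n) * (2 * fact n)" using Suc by (intro mult_right_mono) auto
    finally show ?thesis by (simp add: algebra_simps)
  qed simp
qed simp

lemma abs_tpw_le: "\<bar>t\<bar> \<le> 2 \<Longrightarrow> \<bar>tpw r q t\<bar> \<le> 2"
proof (cases "q \<le> r")
  case True
  assume t: "\<bar>t\<bar> \<le> 2"
  have "\<bar>tpw r q t\<bar> = \<bar>t\<bar> ^ (r - q) / fact (r - q)"
    using True by (simp add: tpw_def power_abs)
  also have "\<dots> \<le> 2 ^ (r - q) / fact (r - q)"
    using t by (intro divide_right_mono power_mono) auto
  also have "\<dots> \<le> 2"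
    using two_power_le_fact[of "r - q"] by (simp add: divide_le_eq)
  finally show ?thesis .
qed (simp add: tpw_def)

lemma tpw_shift_has_derivative:
  "((\<lambda>x. tpw r q (x - c)) has_real_derivative tpw r (Suc q) (x - c)) (at x)"
proof -
  have "((\<lambda>x. x - c) has_real_derivative 1) (at x)"
    by (auto intro!: derivative_eq_intros)
  from DERIV_chain2[where f = "tpw r q" and g = "\<lambda>x. x - c", OF tpw_has_derivative this]
  show ?thesis by simp
qed

lemma tendsto_tpw_shift: "((\<lambda>y. tpw r q (y - c)) \<longlongrightarrow> tpw r q (x - c)) (at x within A)"
  using DERIV_isCont[OF tpw_shift_has_derivative[of r q c x]]
  by (auto simp: isCont_def intro: tendsto_within_subset)

locale singular_points =
  fixes a :: "nat \<Rightarrow> real"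
  assumes inj_a: "inj a" and range_a: "range a \<subseteq> {-1<..<1}"
begin

text \<open>Index 0 is kept for the monomials, so \<open>a i\<close> has index i + 1.\<close>

definition center :: "nat \<Rightarrow> real" where
  "center j = (case j of 0 \<Rightarrow> 0 | Suc i \<Rightarrow> a i)"

text \<open>
  \<open>trunc j m q\<close> is the left-continuous and \<open>rtrunc j m q\<close> the right-continuous version of the \<open>q\<close>-th
  derivative of \<open>(x - a\<^sub>i)\<^sub>+\<^sup>r / r!\<close>, where \<open>j = i + 1\<close> and \<open>r = j + m > i\<close>; for \<open>j = 0\<close> the function is \<open>x\<^sup>m / m!\<close>.
\<close>

definition trunc :: "nat \<Rightarrow> nat \<Rightarrow> nat \<Rightarrow> real \<Rightarrow> real" where
  "trunc j m q x = (if j = 0 \<or> center j < x then tpw (j + m) q (x - center j) else 0)"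

definition rtrunc :: "nat \<Rightarrow> nat \<Rightarrow> nat \<Rightarrow> real \<Rightarrow> real" where
  "rtrunc j m q x = (if j = 0 \<or> center j \<le> x then tpw (j + m) q (x - center j) else 0)"

lemma center_0 [simp]: "center 0 = 0" and center_Suc [simp]: "center (Suc i) = a i"
  by (simp_all add: center_def)

lemma a_bounds: "- 1 < a i" "a i < 1"
  using range_a by (auto simp: image_subset_iff)

lemma center_bounds: "- 1 < center j" "center j < 1"
  using a_bounds by (cases j; auto)+

lemma trunc_tendsto_left: "(trunc j m q \<longlongrightarrow> trunc j m q x) (at_left x)"
proof (cases "j = 0 \<or> center j < x")
  case True
  have "eventually (\<lambda>y. trunc j m q y = tpw (j + m) q (y - center j)) (at_left x)"
  proof (cases "j = 0")
    case False
    then have "eventually (\<lambda>y. center j < y) (at_left x)"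
      using True by (auto intro: eventually_at_left_real order_tendstoD)
    then show ?thesis by eventually_elim (simp add: trunc_def)
  qed (simp add: trunc_def)
  then show ?thesis
    using tendsto_tpw_shift[of "j + m" q "center j" x "{..<x}"] True
    by (subst tendsto_cong) (simp_all add: trunc_def)
next
  case False
  have "eventually (\<lambda>y. y < x) (at_left x)" by (simp add: eventually_at_filter)
  then have "eventually (\<lambda>y. trunc j m q y = 0) (at_left x)"
    by eventually_elim (use False in \<open>auto simp: trunc_def\<close>)
  then show ?thesis using False by (intro tendsto_eventually) (simp add: trunc_def[of j m q x])
qed

lemma trunc_tendsto_right: "(trunc j m q \<longlongrightarrow> rtrunc j m q x) (at_right x)"
proof (cases "j = 0 \<or> center j \<le> x")
  case True
  have "eventually (\<lambda>y. x < y) (at_right x)" by (simp add: eventually_at_filter)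
  then have "eventually (\<lambda>y. trunc j m q y = tpw (j + m) q (y - center j)) (at_right x)"
    by eventually_elim (use True in \<open>auto simp: trunc_def\<close>)
  then show ?thesis
    using tendsto_tpw_shift[of "j + m" q "center j" x "{x<..}"] True
    by (subst tendsto_cong) (simp_all add: rtrunc_def)
next
  case False
  then have "eventually (\<lambda>y. y < center j) (at_right x)"
    by (auto intro: order_tendstoD)
  then have "eventually (\<lambda>y. trunc j m q y = 0) (at_right x)"
    by eventually_elim (use False in \<open>auto simp: trunc_def\<close>)
  then show ?thesis using False by (intro tendsto_eventually) (simp add: rtrunc_def)
qed

text \<open>For q < j the exponent j + m - q is positive, so both versions vanish at the centre.
  With j = i + 1 this covers the orders q \<le> i, in which elements of \<open>V_space a\<close> are
  continuous at \<open>a i\<close>.\<close>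

lemma rtrunc_eq_trunc:
  assumes "x \<noteq> center j \<or> j = 0 \<or> q < j"
  shows "rtrunc j m q x = trunc j m q x"
  using assms by (auto simp: rtrunc_def trunc_def tpw_0)

text \<open>Only the derivative of order r = j + m jumps at the centre, and by exactly 1: this
  allows a coefficient to be read off from a jump.\<close>

lemma rtrunc_minus_trunc:
  assumes "j > 0" "x = center j"
  shows "rtrunc j m q x - trunc j m q x = (if q = j + m then 1 else 0)"
  using assms by (auto simp: rtrunc_def trunc_def tpw_0)

lemma trunc_isCont:
  assumes "x \<noteq> center j \<or> j = 0 \<or> q < j"
  shows "isCont (trunc j m q) x"
  unfolding isCont_def filterlim_at_split
  using trunc_tendsto_left[of j m q x] trunc_tendsto_right[of j m q x] rtrunc_eq_trunc[OF assms] by simp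

lemma trunc_has_derivative:
  assumes "x \<noteq> center j \<or> j = 0 \<or> Suc q < j"
  shows "(trunc j m q has_real_derivative trunc j m (Suc q) x) (at x)"
proof -
  consider "j = 0" | "j > 0" "x > center j" | "j > 0" "x < center j" | "x = center j" "Suc q < j"
    using assms by fastforce
  then show ?thesis
  proof cases
    case 1
    then show ?thesis
      using tpw_shift_has_derivative[of "j + m" q "center j" x] by (simp add: trunc_def[abs_def])
  next
    case 2
    have "((\<lambda>x. tpw (j + m) q (x - center j)) has_real_derivative trunc j m (Suc q) x) (at x)"
      using tpw_shift_has_derivative[of "j + m" q "center j" x] 2 by (simp add: trunc_def)
    then show ?thesis
      by (rule has_field_derivative_transform_within_open[of _ _ _ "{center j<..}"])
         (use 2 in \<open>auto simp: trunc_def\<close>)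
  next
    case 3
    have "((\<lambda>x. 0) has_real_derivative trunc j m (Suc q) x) (at x)"
      using 3 by (simp add: trunc_def)
    then show ?thesis
      by (rule has_field_derivative_transform_within_open[of _ _ _ "{..<center j}"])
         (use 3 in \<open>auto simp: trunc_def\<close>)
  next
    case 4
    \<comment> \<open>At the centre itself the exponent n is at least 2, so the difference quotient
      is at most |h|.\<close>
    define n where "n = j + m - q"
    have n: "n \<ge> 2" using 4 by (simp add: n_def)
    have tr: "trunc j m q (x + h) = (if h > 0 then h ^ n / fact n else 0)" for h
      using 4 by (auto simp: trunc_def tpw_def n_def)
    have "((\<lambda>h. (trunc j m q (x + h) - trunc j m q x) / h) \<longlongrightarrow> 0) (at 0)"
    proof (rule Lim_null_comparison)
      have "eventually (\<lambda>h::real. \<bar>h\<bar> < 1) (at 0)"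
        by (auto simp: eventually_at dist_real_def intro!: exI[of _ 1])
      then show "eventually (\<lambda>h. norm ((trunc j m q (x + h) - trunc j m q x) / h) \<le> \<bar>h\<bar>) (at 0)"
      proof eventually_elim
        case (elim h)
        show ?case
        proof (cases "h > 0")
          case True
          have "h ^ n \<le> h ^ 2" using n elim True by (intro power_decreasing) auto
          then have "h ^ n / fact n \<le> h ^ 2 / 1"
            using True by (intro frac_le) auto
          then show ?thesis using True tr[of h] tr[of 0] by (simp add: divide_le_eq power2_eq_square mult_ac)
        qed (use tr[of h] tr[of 0] in auto)
      qed
      show "((\<lambda>h::real. \<bar>h\<bar>) \<longlongrightarrow> 0) (at 0)"
        by (rule tendsto_eq_intros refl | simp)+
    qed
    moreover have "trunc j m (Suc q) x = 0"
      using 4 by (simp add: trunc_def)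
    ultimately show ?thesis
      by (simp add: DERIV_def)
  qed
qed

lemma abs_trunc_le: "x \<in> {-1<..<1} \<Longrightarrow> \<bar>trunc j m q x\<bar> \<le> 2"
  using abs_tpw_le[of "x - center j"] center_bounds[of j] by (auto simp: trunc_def)

lemma abs_rtrunc_le: "x \<in> {-1<..<1} \<Longrightarrow> \<bar>rtrunc j m q x\<bar> \<le> 2"
  using abs_tpw_le[of "x - center j"] center_bounds[of j] by (auto simp: rtrunc_def)

text \<open>All basis functions in one sequence, through \<open>prod_decode\<close>: a coefficient
  family is then a point of a product indexed by the natural numbers, where boxes are
  compact.\<close>

definition E :: "nat \<Rightarrow> nat \<Rightarrow> real \<Rightarrow> real" where
  "E i = trunc (fst (prod_decode i)) (snd (prod_decode i))"

definition Er :: "nat \<Rightarrow> nat \<Rightarrow> real \<Rightarrow> real" where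
  "Er i = rtrunc (fst (prod_decode i)) (snd (prod_decode i))"

text \<open>The q times differentiated series, with left limits at the singular points;
  \<open>Gr\<close> has the right limits.\<close>

definition G :: "(nat \<Rightarrow> real) \<Rightarrow> nat \<Rightarrow> real \<Rightarrow> real" where
  "G c q x = suminf (\<lambda>i. c i * E i q x)"

definition Gr :: "(nat \<Rightarrow> real) \<Rightarrow> nat \<Rightarrow> real \<Rightarrow> real" where
  "Gr c q x = suminf (\<lambda>i. c i * Er i q x)"

lemma abs_E_le: "x \<in> {-1<..<1} \<Longrightarrow> \<bar>E i q x\<bar> \<le> 2"
  by (simp add: E_def abs_trunc_le)

lemma abs_Er_le: "x \<in> {-1<..<1} \<Longrightarrow> \<bar>Er i q x\<bar> \<le> 2"
  by (simp add: Er_def abs_rtrunc_le)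

lemma norm_term_le:
  "x \<in> {-1<..<1} \<Longrightarrow> norm (c i * E i q x) \<le> 2 * \<bar>c i\<bar>"
  "x \<in> {-1<..<1} \<Longrightarrow> norm (c i * Er i q x) \<le> 2 * \<bar>c i\<bar>"
  using mult_left_mono[OF abs_E_le[of x i q], of "\<bar>c i\<bar>"] mult_left_mono[OF abs_Er_le[of x i q], of "\<bar>c i\<bar>"]
  by (auto simp: abs_mult mult.commute)

lemma center_eq_imp:
  assumes "x \<notin> a ` {..<q}"
  shows "x \<noteq> center j \<or> j = 0 \<or> q < j"
  using assms by (cases j) (force simp: image_iff not_less)+

lemma E_has_derivative:
  "x \<notin> a ` {..<Suc q} \<Longrightarrow> (E i q has_real_derivative E i (Suc q) x) (at x)"
  unfolding E_def by (rule trunc_has_derivative) (use center_eq_imp in blast)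

lemma Er_eq_E: "x \<notin> a ` {..<q} \<Longrightarrow> Er i q x = E i q x"
  unfolding E_def Er_def by (rule rtrunc_eq_trunc) (use center_eq_imp in blast)

lemma E_isCont: "x \<notin> a ` {..<q} \<Longrightarrow> isCont (E i q) x"
  unfolding E_def by (rule trunc_isCont) (use center_eq_imp in blast)

lemma Gr_eq_G: "x \<notin> a ` {..<q} \<Longrightarrow> Gr c q x = G c q x"
  by (simp add: G_def Gr_def Er_eq_E)

text \<open>The domain of the q-th derivative of an element of V. It is open and still contains
  \<open>a i\<close> for i \<ge> q.\<close>

definition U :: "nat \<Rightarrow> real set" where
  "U q = {-1<..<1} - a ` {..<q}"

lemma open_U: "open (U q)"
  unfolding U_def by (intro open_Diff finite_imp_closed) auto

lemma U_antimono: "q \<le> q' \<Longrightarrow> U q' \<subseteq> U q"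
  by (auto simp: U_def)

lemma a_in_U: "q \<le> i \<Longrightarrow> a i \<in> U q"
  using a_bounds inj_a by (force simp: U_def inj_def)

lemma not_range_in_U: "x \<in> {-1<..<1} - range a \<Longrightarrow> x \<in> U q"
  by (auto simp: U_def)

lemma eventually_U_within: "x \<in> {-1<..<1} \<Longrightarrow> eventually (\<lambda>y. y \<in> U q) (at x within A)"
proof -
  assume x: "x \<in> {-1<..<1}"
  \<comment> \<open>x may itself be a removed point; only the others are excluded here, since the
    punctured filter ignores x.\<close>
  have "eventually (\<lambda>y. y \<in> {-1<..<1} - (a ` {..<q} - {x})) (nhds x)"
    using x by (intro eventually_nhds_in_open open_Diff finite_imp_closed) auto
  then have "eventually (\<lambda>y. y \<in> {-1<..<1} - (a ` {..<q} - {x}) \<and> y \<noteq> x) (at x within A)"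
    by (auto simp: eventually_at_filter elim: eventually_mono)
  then show ?thesis by eventually_elim (auto simp: U_def)
qed

context
  fixes c :: "nat \<Rightarrow> real"
  assumes c: "summable (\<lambda>i. \<bar>c i\<bar>)"
begin

lemma summable_G: "x \<in> {-1<..<1} \<Longrightarrow> summable (\<lambda>i. c i * E i q x)"
  by (rule summable_comparison_test'[OF summable_mult[OF c, of 2], of 0]) (use norm_term_le in auto)

text \<open>For fixed q all terms are differentiable off one finite set of singular points, so one
  ball around x serves for every term, and the majorants 2|c_i| make the differentiated series
  converge uniformly on it.\<close>

lemma G_has_derivative:
  assumes "x \<in> U (Suc q)"
  shows "(G c q has_real_derivative G c (Suc q) x) (at x)"
proof -
  obtain d where d: "d > 0" "ball x d \<subseteq> U (Suc q)"
    using open_U assms by (meson open_contains_ball)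
  have "((\<lambda>x. suminf (\<lambda>i. c i * E i q x)) has_real_derivative (suminf (\<lambda>i. c i * E i (Suc q) x))) (at x)"
  proof (rule has_field_derivative_series'(2)[of "ball x d"])
    fix n y assume "y \<in> ball x d"
    then have "y \<notin> a ` {..<Suc q}" using d by (auto simp: U_def)
    then show "((\<lambda>y. c n * E n q y) has_real_derivative c n * E n (Suc q) y) (at y within ball x d)"
      by (intro DERIV_cmult has_field_derivative_at_within[OF E_has_derivative])
  next
    show "uniformly_convergent_on (ball x d) (\<lambda>n x. \<Sum>i<n. c i * E i (Suc q) x)"
      by (rule Weierstrass_m_test'[OF _ summable_mult[OF c, of 2]])
         (use d in \<open>auto simp: U_def intro!: norm_term_le[simplified]\<close>)
  next
    show "summable (\<lambda>n. c n * E n q x)"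
      using assms by (intro summable_G) (auto simp: U_def)
  qed (use d in auto)
  then show ?thesis by (simp add: G_def[abs_def])
qed

text \<open>Dominated convergence with majorants 2|c_k|. It also covers the points missing from
  \<open>U q\<close>, where the limits from the two sides may differ.\<close>

lemma G_tendsto_left:
  assumes "x \<in> {-1<..<1}"
  shows "(G c q \<longlongrightarrow> G c q x) (at_left x)"
proof -
  have "eventually (\<lambda>y. y \<in> {-1<..<1}) (at_left x)"
    using eventually_U_within[OF assms, of 0] by (simp add: U_def)
  then have ev: "eventually (\<lambda>(k, y). norm (c k * E k q y) \<le> 2 * \<bar>c k\<bar>) (at_top \<times>\<^sub>F at_left x)"
    unfolding eventually_prod_filter
    by (intro exI[of _ "\<lambda>_. True"] exI[of _ "\<lambda>y. y \<in> {-1<..<1}"]) (use norm_term_le(1) in auto)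
  show ?thesis
    unfolding G_def[abs_def]
    by (rule tannerys_theorem[OF _ ev summable_mult[OF c], THEN conjunct2, THEN conjunct2])
       (auto simp: E_def intro!: tendsto_intros trunc_tendsto_left)
qed

lemma G_tendsto_right:
  assumes "x \<in> {-1<..<1}"
  shows "(G c q \<longlongrightarrow> Gr c q x) (at_right x)"
proof -
  have "eventually (\<lambda>y. y \<in> {-1<..<1}) (at_right x)"
    using eventually_U_within[OF assms, of 0] by (simp add: U_def)
  then have ev: "eventually (\<lambda>(k, y). norm (c k * E k q y) \<le> 2 * \<bar>c k\<bar>) (at_top \<times>\<^sub>F at_right x)"
    unfolding eventually_prod_filter
    by (intro exI[of _ "\<lambda>_. True"] exI[of _ "\<lambda>y. y \<in> {-1<..<1}"]) (use norm_term_le(1) in auto)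
  show ?thesis
    unfolding G_def[abs_def] Gr_def
    by (rule tannerys_theorem[OF _ ev summable_mult[OF c], THEN conjunct2, THEN conjunct2])
       (auto simp: E_def Er_def intro!: tendsto_intros trunc_tendsto_right)
qed

lemma G_isCont:
  assumes "x \<in> U q"
  shows "isCont (G c q) x"
  unfolding isCont_def filterlim_at_split
  using G_tendsto_left[of x q] G_tendsto_right[of x q] Gr_eq_G[of x q c] assms by (auto simp: U_def)

definition gfun :: "real \<Rightarrow> real" where
  "gfun x = (if x \<in> {-1<..<1} then G c 0 x else 0)"

lemma deriv_gfun: "x \<in> U q \<Longrightarrow> (deriv ^^ q) gfun x = G c q x"
proof (induction q arbitrary: x)
  case 0
  then show ?case by (simp add: gfun_def U_def)
next
  case (Suc q)
  have "eventually (\<lambda>y. y \<in> U q) (nhds x)"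
    using Suc.prems U_antimono[of q "Suc q"] open_U by (intro eventually_nhds_in_open) auto
  then have "eventually (\<lambda>y. (deriv ^^ q) gfun y = G c q y) (nhds x)"
    by eventually_elim (rule Suc.IH)
  then have "deriv ((deriv ^^ q) gfun) x = deriv (G c q) x"
    by (rule deriv_cong_ev) simp
  also have "\<dots> = G c (Suc q) x"
    by (rule DERIV_imp_deriv[OF G_has_derivative[OF Suc.prems]])
  finally show ?case by simp
qed

lemma gfun_differentiable: "x \<in> U (Suc q) \<Longrightarrow> (deriv ^^ q) gfun differentiable (at x)"
proof -
  assume x: "x \<in> U (Suc q)"
  have "((deriv ^^ q) gfun has_real_derivative G c (Suc q) x) (at x)"
    by (rule has_field_derivative_transform_within_open[OF G_has_derivative[OF x] open_U[of q]])
       (use x U_antimono[of q "Suc q"] deriv_gfun in auto)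
  then show ?thesis by (auto simp: real_differentiable_def)
qed

lemma Ck_on_gfun: "Ck_on k gfun (U k)"
  unfolding Ck_on_def
proof (intro conjI allI impI ballI)
  fix m x assume "m < k" "x \<in> U k"
  then show "(deriv ^^ m) gfun differentiable (at x)"
    using U_antimono[of "Suc m" k] by (intro gfun_differentiable) auto
next
  have "continuous_on (U k) (G c k)"
    by (intro continuous_at_imp_continuous_on ballI G_isCont)
  then show "continuous_on (U k) ((deriv ^^ k) gfun)"
    by (subst continuous_on_cong[OF refl deriv_gfun]) auto
qed

lemma deriv_gfun_tendsto_left:
  "x \<in> {-1<..<1} \<Longrightarrow> ((deriv ^^ q) gfun \<longlongrightarrow> G c q x) (at_left x)"
  using G_tendsto_left[of x q] eventually_U_within[of x q "{..<x}"]
  by (subst tendsto_cong[where g = "G c q"]) (auto elim: eventually_mono simp: deriv_gfun)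

lemma deriv_gfun_tendsto_right:
  "x \<in> {-1<..<1} \<Longrightarrow> ((deriv ^^ q) gfun \<longlongrightarrow> Gr c q x) (at_right x)"
  using G_tendsto_right[of x q] eventually_U_within[of x q "{x<..}"]
  by (subst tendsto_cong[where g = "G c q"]) (auto elim: eventually_mono simp: deriv_gfun)

lemma left_nth_deriv_gfun: "x \<in> {-1<..<1} \<Longrightarrow> left_nth_deriv q gfun x = G c q x"
  unfolding left_nth_deriv_def by (intro tendsto_Lim deriv_gfun_tendsto_left) auto

lemma right_nth_deriv_gfun: "x \<in> {-1<..<1} \<Longrightarrow> right_nth_deriv q gfun x = Gr c q x"
  unfolding right_nth_deriv_def by (intro tendsto_Lim deriv_gfun_tendsto_right) auto

lemma gfun_in_V: "gfun \<in> V_space a"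
  unfolding V_space_def mem_Collect_eq
proof (intro conjI ballI allI impI)
  show "gfun x = 0" if "x \<notin> {-1<..<1}" for x
    using that unfolding gfun_def by auto
  have "continuous_on (U 0) ((deriv ^^ 0) gfun)"
    using Ck_on_gfun[of 0] unfolding Ck_on_def by blast
  then show "continuous_on {-1<..<1} gfun" by (simp add: U_def)
  \<comment> \<open>The representative is the same for every k; only the neighbourhood
    \<open>U k\<close> shrinks.\<close>
  show "weakly_smooth_germ gfun x" if "x \<in> {-1<..<1} - range a" for x
    unfolding weakly_smooth_germ_def
    using that by (intro exI[of _ gfun]) (use Ck_on_gfun open_U not_range_in_U in \<open>auto, blast\<close>)
  show "\<exists>S. open S \<and> a p \<in> S \<and> Ck_on p gfun S" for p
    by (intro exI[of _ "U p"]) (simp add: open_U a_in_U Ck_on_gfun)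
  show "\<exists>l. ((deriv ^^ p) gfun \<longlongrightarrow> l) (at_left s)" "\<exists>l. ((deriv ^^ p) gfun \<longlongrightarrow> l) (at_right s)"
    if "s \<in> range a" for s p
    using deriv_gfun_tendsto_left[OF subsetD[OF range_a that], of p]
      deriv_gfun_tendsto_right[OF subsetD[OF range_a that], of p] by blast+
qed

end

end

subsection \<open>Approximation by splines\<close>

lemma eventually_deriv_funpow_eq:
  fixes f g :: "real \<Rightarrow> real"
  assumes "eventually (\<lambda>y. f y = g y) (nhds x)"
  shows "eventually (\<lambda>y. (deriv ^^ q) f y = (deriv ^^ q) g y) (nhds x)"
proof (induction q)
  case (Suc q)
  then have "eventually (\<lambda>y. eventually (\<lambda>z. (deriv ^^ q) f z = (deriv ^^ q) g z) (nhds y)) (nhds x)"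
    by (simp add: eventually_eventually)
  then show ?case
    by eventually_elim (auto intro: deriv_cong_ev)
qed (use assms in simp)

text \<open>The mean value inequality with finitely many exceptional points, obtained by integrating
  D', because an integral ignores finite sets.\<close>

lemma abs_diff_le_derivative_off_finite:
  fixes D :: "real \<Rightarrow> real"
  assumes "finite S" "u \<le> v" "continuous_on {u..v} D" "e \<ge> 0"
    and D': "\<And>x. x \<in> {u<..<v} - S \<Longrightarrow> (D has_real_derivative D' x) (at x) \<and> \<bar>D' x\<bar> \<le> e"
  shows "\<bar>D v - D u\<bar> \<le> e * (v - u)"
proof -
  have "(D' has_integral (D v - D u)) {u..v}"
    using assms by (intro fundamental_theorem_of_calculus_interior_strong[OF assms(1)])
      (auto simp: has_real_derivative_iff_has_vector_derivative)
  then have "norm (D v - D u) \<le> e * measure lborel (cbox u v)"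
    using D' assms(1,4) by (intro has_integral_bound_spike_finite[where S = "S \<union> {u, v}" and f = D']) auto
  then show ?thesis using assms(2) by simp
qed

text \<open>\<open>w s\<close> is the jump of d at s. Once a Heaviside step has been subtracted for
  each point of A, only removable discontinuities are left.\<close>

lemma remove_jumps:
  fixes d :: "real \<Rightarrow> real"
  assumes "finite A" "A \<subseteq> {-1<..<1}"
    and "\<And>x. x \<in> {-1<..<1} - A \<Longrightarrow> isCont d x"
    and "\<And>s. s \<in> A \<Longrightarrow> \<exists>l. (d \<longlongrightarrow> l) (at_left s)"
    and "\<And>s. s \<in> A \<Longrightarrow> \<exists>l. (d \<longlongrightarrow> l) (at_right s)"
  shows "\<exists>w D. continuous_on {-1<..<1} D \<and>
    (\<forall>x\<in>{-1<..<1} - A. D x = d x - (\<Sum>s\<in>A. w s * (if s < x then 1 else 0)))"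
  using assms
proof (induction A arbitrary: d rule: finite_induct)
  case empty
  then have "continuous_on {-1<..<1} d"
    by (intro continuous_at_imp_continuous_on) auto
  then show ?case by auto
next
  case (insert s A)
  obtain l r where l: "(d \<longlongrightarrow> l) (at_left s)" and r: "(d \<longlongrightarrow> r) (at_right s)"
    using insert.prems by blast
  \<comment> \<open>The value l at s fills the gap: the left limit is l, and the right limit is r -
    (r - l).\<close>
  define d' where "d' x = (if x = s then l else d x - (r - l) * (if s < x then 1 else 0))" for x
  have near: "eventually (\<lambda>z. d' z = d z - (r - l) * (if s < y then 1 else 0)) (nhds y)" if "y \<noteq> s" for y
  proof (cases "s < y")
    case True
    then have "eventually (\<lambda>z. z \<in> {s<..}) (nhds y)" by (intro eventually_nhds_in_open) auto
    then show ?thesis by eventually_elim (use True in \<open>auto simp: d'_def\<close>)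
  next
    case False
    then have "eventually (\<lambda>z. z \<in> {..<s}) (nhds y)" using that by (intro eventually_nhds_in_open) auto
    then show ?thesis by eventually_elim (use False in \<open>auto simp: d'_def\<close>)
  qed
  have tends: "(d' \<longlongrightarrow> L - (r - l) * (if s < y then 1 else 0)) (at y within B)"
    if "y \<noteq> s" "(d \<longlongrightarrow> L) (at y within B)" for y L B
  proof -
    have "((\<lambda>z. d z - (r - l) * (if s < y then 1 else 0)) \<longlongrightarrow> L - (r - l) * (if s < y then 1 else 0)) (at y within B)"
      using that(2) by (intro tendsto_intros)
    then show ?thesis
      using filter_leD[OF at_within_le_nhds near[OF that(1)], of B] by (subst tendsto_cong) auto
  qed
  have "\<exists>w D. continuous_on {-1<..<1} D \<and>
    (\<forall>x\<in>{-1<..<1} - A. D x = d' x - (\<Sum>s\<in>A. w s * (if s < x then 1 else 0)))"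
  proof (rule insert.IH)
    show "A \<subseteq> {-1<..<1}" using insert.prems(1) by simp
    show "isCont d' x" if x: "x \<in> {-1<..<1} - A" for x
    proof (cases "x = s")
      case False
      then have "(d \<longlongrightarrow> d x) (at x)" using insert.prems(2) x by (auto simp: isCont_def)
      then show ?thesis using tends[OF False] False by (simp add: isCont_def d'_def)
    next
      case True
      have "(d' \<longlongrightarrow> l) (at_left s)"
      proof -
        have "eventually (\<lambda>z. z < s) (at_left s)" by (simp add: eventually_at_filter)
        then have "eventually (\<lambda>z. d' z = d z) (at_left s)"
          by eventually_elim (auto simp: d'_def)
        then show ?thesis using l by (subst tendsto_cong) auto
      qed
      moreover have "(d' \<longlongrightarrow> l) (at_right s)"
      proof -
        have "eventually (\<lambda>z. s < z) (at_right s)" by (simp add: eventually_at_filter)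
        then have *: "eventually (\<lambda>z. d' z = d z - (r - l)) (at_right s)"
          by eventually_elim (auto simp: d'_def)
        have "((\<lambda>z. d z - (r - l)) \<longlongrightarrow> r - (r - l)) (at_right s)"
          using r by (intro tendsto_intros)
        then show ?thesis using * by (subst tendsto_cong) auto
      qed
      ultimately show ?thesis
        unfolding True isCont_def filterlim_at_split by (simp add: d'_def)
    qed
    show "\<exists>l. (d' \<longlongrightarrow> l) (at_left t)" "\<exists>l. (d' \<longlongrightarrow> l) (at_right t)" if "t \<in> A" for t
    proof -
      have "t \<noteq> s" using that insert.hyps by auto
      then show "\<exists>l. (d' \<longlongrightarrow> l) (at_left t)" "\<exists>l. (d' \<longlongrightarrow> l) (at_right t)"
        using tends[of t] insert.prems(3,4)[of t] that by blast+
    qed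
  qed
  then obtain w D where D: "continuous_on {-1<..<1} D"
    "\<And>x. x \<in> {-1<..<1} - A \<Longrightarrow> D x = d' x - (\<Sum>s\<in>A. w s * (if s < x then 1 else 0))" by blast
  have "D x = d x - (\<Sum>t\<in>insert s A. (w(s := r - l)) t * (if t < x then 1 else 0))"
    if x: "x \<in> {-1<..<1} - insert s A" for x
  proof -
    have "(\<Sum>t\<in>A. (w(s := r - l)) t * (if t < x then 1 else 0)) = (\<Sum>t\<in>A. w t * (if t < x then 1 else 0))"
      using insert.hyps by (intro sum.cong) auto
    then show ?thesis using D(2)[of x] x insert.hyps by (simp add: d'_def)
  qed
  then show ?case using D(1) by blast
qed

lemma summable_finite_support:
  "finite {i. b i \<noteq> (0::real)} \<Longrightarrow> summable (\<lambda>i. \<bar>b i\<bar>)"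
  by (rule summable_finite[of "{i. b i \<noteq> 0}"]) auto

lemma finite_support_add_units:
  assumes "finite I" "finite {i. b i \<noteq> (0::real)}"
  shows "finite {i. b i + (\<Sum>k\<in>I. if i = \<kappa> k then v k else 0) \<noteq> 0}"
proof (rule finite_subset)
  show "{i. b i + (\<Sum>k\<in>I. if i = \<kappa> k then v k else 0) \<noteq> 0} \<subseteq> {i. b i \<noteq> 0} \<union> \<kappa> ` I"
    by (auto intro!: sum.neutral)
qed (use assms in auto)

context singular_points
begin

text \<open>At \<open>a i\<close> with i > q the C^i neighbourhood in \<open>V_space\<close>
  applies; off S it is the germ condition with k = q + 1.\<close>

lemma V_differentiable:
  assumes f: "f \<in> V_space a" and x: "x \<in> U (Suc q)"
  shows "(deriv ^^ q) f differentiable (at x)"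
proof (cases "x \<in> range a")
  case True
  then obtain i where i: "x = a i" "i \<ge> Suc q" using x by (force simp: U_def)
  then obtain W where "x \<in> W" "Ck_on i f W" using f unfolding V_space_def by blast
  then show ?thesis using i by (auto simp: Ck_on_def)
next
  case False
  then have "weakly_smooth_germ f x" using f x by (auto simp: V_space_def U_def)
  then obtain g W where g: "eventually (\<lambda>y. g y = f y) (nhds x)" "x \<in> W" "Ck_on (Suc q) g W"
    unfolding weakly_smooth_germ_def by blast
  then have "(deriv ^^ q) g differentiable (at x)" by (auto simp: Ck_on_def)
  then obtain D where "((deriv ^^ q) g has_real_derivative D) (at x)"
    by (auto simp: real_differentiable_def)
  then have "((deriv ^^ q) f has_real_derivative D) (at x)"
    using DERIV_cong_ev[OF refl eventually_deriv_funpow_eq[OF g(1)] refl] by blast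
  then show ?thesis by (auto simp: real_differentiable_def)
qed

lemma V_isCont:
  assumes f: "f \<in> V_space a" and x: "x \<in> U q"
  shows "isCont ((deriv ^^ q) f) x"
proof (cases "x = a q")
  case True
  then obtain W where "open W" "x \<in> W" "Ck_on q f W" using f unfolding V_space_def by blast
  then show ?thesis by (auto simp: Ck_on_def continuous_on_eq_continuous_at)
next
  case False
  then have "x \<in> U (Suc q)" using x by (auto simp: U_def less_Suc_eq)
  then show ?thesis
    using V_differentiable[OF f] by (simp add: differentiable_imp_continuous_within)
qed

lemma V_has_derivative:
  assumes "f \<in> V_space a" "x \<in> U (Suc q)"
  shows "((deriv ^^ q) f has_real_derivative (deriv ^^ Suc q) f x) (at x)"
  using V_differentiable[OF assms] by (simp add: DERIV_deriv_iff_real_differentiable)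

text \<open>The change of coefficients is a sum of indicators, so that \<kappa> need not be
  injective and may hit the support of b.\<close>

lemma G_add_units:
  assumes "finite I" "summable (\<lambda>i. \<bar>b i\<bar>)" "x \<in> {-1<..<1}"
  shows "G (\<lambda>i. b i + (\<Sum>k\<in>I. if i = \<kappa> k then v k else 0)) q x = G b q x + (\<Sum>k\<in>I. v k * E (\<kappa> k) q x)"
proof -
  have "(\<lambda>i. \<Sum>k\<in>I. if i = \<kappa> k then v k * E i q x else 0) sums (\<Sum>k\<in>I. v k * E (\<kappa> k) q x)"
  proof (rule sums_sum)
    show "(\<lambda>i. if i = \<kappa> k then v k * E i q x else 0) sums (v k * E (\<kappa> k) q x)" for k
      using sums_single[of "\<kappa> k" "\<lambda>i. v k * E i q x"] by simp
  qed
  moreover have "(\<lambda>i. b i * E i q x) sums G b q x"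
    unfolding G_def using summable_G[OF assms(2,3)] by (rule summable_sums)
  ultimately have "(\<lambda>i. b i * E i q x + (\<Sum>k\<in>I. if i = \<kappa> k then v k * E i q x else 0)) sums
      (G b q x + (\<Sum>k\<in>I. v k * E (\<kappa> k) q x))"
    by (rule sums_add[rotated])
  moreover have "b i * E i q x + (\<Sum>k\<in>I. if i = \<kappa> k then v k * E i q x else 0) =
      (b i + (\<Sum>k\<in>I. if i = \<kappa> k then v k else 0)) * E i q x" for i
    unfolding distrib_right sum_distrib_right
    by (intro arg_cong2[where f = "(+)"] sum.cong) auto
  ultimately show ?thesis
    unfolding G_def[of "\<lambda>i. b i + (\<Sum>k\<in>I. if i = \<kappa> k then v k else 0)"] by (simp add: sums_iff)
qed

text \<open>These indices have r = q, so the q-th derivative is the Heaviside step at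
  \<open>a i\<close>. They exist exactly for i < q, that is, for the points where the q-th
  derivative of an element of V may jump.\<close>

lemma E_step: "i < q \<Longrightarrow> E (prod_encode (Suc i, q - Suc i)) q x = (if a i < x then 1 else 0)"
  by (simp add: E_def trunc_def tpw_def)

lemma E_step_higher: "i < q \<Longrightarrow> q < q' \<Longrightarrow> E (prod_encode (Suc i, q - Suc i)) q' x = 0"
  by (simp add: E_def trunc_def tpw_def)

lemma E_poly: "E (prod_encode (0, m)) q x = tpw m q x"
  by (simp add: E_def trunc_def)

lemma spline_correction:
  assumes f: "f \<in> V_space a" and b: "finite {i. b i \<noteq> 0}"
  shows "\<exists>w D. continuous_on {-1<..<1} D \<and>
    (\<forall>x\<in>U q. D x = (deriv ^^ q) f x - G b q x - (\<Sum>i<q. w i * (if a i < x then 1 else 0)))"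
proof -
  note sb = summable_finite_support[OF b]
  let ?d = "\<lambda>x. (deriv ^^ q) f x - G b q x"
  have "\<exists>w D. continuous_on {-1<..<1} D \<and>
    (\<forall>x\<in>{-1<..<1} - a ` {..<q}. D x = ?d x - (\<Sum>s\<in>a ` {..<q}. w s * (if s < x then 1 else 0)))"
  proof (rule remove_jumps)
    show "a ` {..<q} \<subseteq> {-1<..<1}" using range_a by auto
    show "isCont ?d x" if "x \<in> {-1<..<1} - a ` {..<q}" for x
      using that V_isCont[OF f, of x q] G_isCont[OF sb, of x q] by (auto simp: U_def)
    show "\<exists>l. (?d \<longlongrightarrow> l) (at_left s)" if "s \<in> a ` {..<q}" for s
    proof -
      have "s \<in> range a" using that by auto
      then obtain l where "((deriv ^^ q) f \<longlongrightarrow> l) (at_left s)" using f unfolding V_space_def by blast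
      moreover have "s \<in> {-1<..<1}" using \<open>s \<in> range a\<close> range_a by blast
      ultimately show ?thesis using G_tendsto_left[OF sb, of s q] by (blast intro: tendsto_diff)
    qed
    show "\<exists>l. (?d \<longlongrightarrow> l) (at_right s)" if "s \<in> a ` {..<q}" for s
    proof -
      have "s \<in> range a" using that by auto
      then obtain l where "((deriv ^^ q) f \<longlongrightarrow> l) (at_right s)" using f unfolding V_space_def by blast
      moreover have "s \<in> {-1<..<1}" using \<open>s \<in> range a\<close> range_a by blast
      ultimately show ?thesis using G_tendsto_right[OF sb, of s q] by (blast intro: tendsto_diff)
    qed
  qed auto
  then obtain w D where D: "continuous_on {-1<..<1} D"
    "\<And>x. x \<in> U q \<Longrightarrow> D x = ?d x - (\<Sum>s\<in>a ` {..<q}. w s * (if s < x then 1 else 0))"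
    unfolding U_def by blast
  have "(\<Sum>s\<in>a ` {..<q}. w s * (if s < x then 1 else 0)) = (\<Sum>i<q. w (a i) * (if a i < x then 1 else 0))" for x
    using inj_a by (subst sum.reindex) (auto simp: inj_def inj_on_def)
  with D show ?thesis
    by (intro exI[of _ "\<lambda>i. w (a i)"] exI[of _ D]) simp
qed

text \<open>The new terms have degree q for the steps and q + l for the polynomial; the factor
  \<open>fact l\<close> turns x^l / l! into x^l. Above order q the steps vanish, and so does a
  constant (n = 0), which preserves what has been achieved in higher orders.\<close>

lemma add_spline:
  assumes b: "finite {i. b i \<noteq> 0}"
  shows "\<exists>b'. finite {i. b' i \<noteq> 0} \<and>
    (\<forall>x\<in>{-1<..<1}. G b' q x = G b q x + (\<Sum>i<q. w i * (if a i < x then 1 else 0)) + (\<Sum>l\<le>n. v l * x ^ l)) \<and>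
    (\<forall>q'>q. \<forall>x\<in>{-1<..<1}. G b' q' x = G b q' x + (\<Sum>l\<le>n. v l * fact l * tpw (q + l) q' x))"
proof -
  define b1 where "b1 i = b i + (\<Sum>k<q. if i = prod_encode (Suc k, q - Suc k) then w k else 0)" for i
  define b2 where "b2 i = b1 i + (\<Sum>l\<le>n. if i = prod_encode (0, q + l) then v l * fact l else 0)" for i
  have b1: "finite {i. b1 i \<noteq> 0}" unfolding b1_def by (rule finite_support_add_units) (use b in auto)
  have b2: "finite {i. b2 i \<noteq> 0}" unfolding b2_def by (rule finite_support_add_units) (use b1 in auto)
  have G1: "G b1 q' x = G b q' x + (\<Sum>k<q. w k * E (prod_encode (Suc k, q - Suc k)) q' x)"
    if "x \<in> {-1<..<1}" for q' x
    unfolding b1_def using that by (intro G_add_units summable_finite_support b) auto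
  have G2: "G b2 q' x = G b1 q' x + (\<Sum>l\<le>n. v l * fact l * tpw (q + l) q' x)"
    if "x \<in> {-1<..<1}" for q' x
    unfolding b2_def E_poly[symmetric] using that by (intro G_add_units summable_finite_support b1) auto
  show ?thesis
  proof (intro exI[of _ b2] conjI ballI allI impI b2)
    fix x :: real assume x: "x \<in> {-1<..<1}"
    show "G b2 q x = G b q x + (\<Sum>i<q. w i * (if a i < x then 1 else 0)) + (\<Sum>l\<le>n. v l * x ^ l)"
      unfolding G1[OF x] G2[OF x]
      by (intro arg_cong2[where f = "(+)"] sum.cong refl) (auto simp: E_step tpw_def)
    fix q' assume "q' > q"
    then show "G b2 q' x = G b q' x + (\<Sum>l\<le>n. v l * fact l * tpw (q + l) q' x)"
      unfolding G1[OF x] G2[OF x] by (simp add: E_step_higher)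
  qed
qed

text \<open>The error does not grow on the way down, because it is integrated from 0 over a length
  less than 1. A polynomial is needed in the top order only, a constant in all others.\<close>

lemma spline_approximation_from:
  assumes f: "f \<in> V_space a" and \<rho>: "0 < \<rho>" "\<rho> < 1" and e: "e > 0" and "q \<le> p"
  shows "\<exists>b. finite {i. b i \<noteq> 0} \<and>
    (\<forall>q'. q \<le> q' \<and> q' \<le> p \<longrightarrow> (\<forall>x\<in>{-\<rho>..\<rho>} \<inter> U q'. \<bar>(deriv ^^ q') f x - G b q' x\<bar> \<le> e))"
  using \<open>q \<le> p\<close>
proof (induction rule: inc_induct)
  case base
  obtain w D where D: "continuous_on {-1<..<1} D"
    "\<And>x. x \<in> U p \<Longrightarrow> D x = (deriv ^^ p) f x - G (\<lambda>_. 0) p x - (\<Sum>i<p. w i * (if a i < x then 1 else 0))"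
    using spline_correction[OF f, of "\<lambda>_. 0" p] by auto
  have "continuous_on {-\<rho>..\<rho>} D" using \<rho> by (intro continuous_on_subset[OF D(1)]) auto
  then obtain P where P: "real_polynomial_function P" "\<And>x. x \<in> {-\<rho>..\<rho>} \<Longrightarrow> \<bar>D x - P x\<bar> < e"
    using Stone_Weierstrass_real_polynomial_function[of "{-\<rho>..\<rho>}" D e] e by auto
  then obtain v n where v: "P = (\<lambda>x. \<Sum>l\<le>n. v l * x ^ l)"
    using real_polynomial_function_iff_sum by auto
  obtain b' where b': "finite {i. b' i \<noteq> 0}"
    "\<And>x. x \<in> {-1<..<1} \<Longrightarrow> G b' p x = G (\<lambda>_. 0) p x + (\<Sum>i<p. w i * (if a i < x then 1 else 0)) + (\<Sum>l\<le>n. v l * x ^ l)"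
    using add_spline[of "\<lambda>_. 0" p w v n] by auto
  have "\<bar>(deriv ^^ p) f x - G b' p x\<bar> \<le> e" if x: "x \<in> {-\<rho>..\<rho>} \<inter> U p" for x
  proof -
    have "x \<in> {-1<..<1}" using x by (auto simp: U_def)
    then have "(deriv ^^ p) f x - G b' p x = D x - P x"
      using D(2)[of x] b'(2)[of x] x by (simp add: v)
    then show ?thesis using P(2)[of x] x by auto
  qed
  then show ?case using b'(1) by (metis order_antisym)
next
  case (step q)
  then obtain b where b: "finite {i. b i \<noteq> 0}"
    "\<And>q' x. Suc q \<le> q' \<Longrightarrow> q' \<le> p \<Longrightarrow> x \<in> {-\<rho>..\<rho>} \<inter> U q' \<Longrightarrow> \<bar>(deriv ^^ q') f x - G b q' x\<bar> \<le> e"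
    by blast
  note sb = summable_finite_support[OF b(1)]
  obtain w D where D: "continuous_on {-1<..<1} D"
    "\<And>x. x \<in> U q \<Longrightarrow> D x = (deriv ^^ q) f x - G b q x - (\<Sum>i<q. w i * (if a i < x then 1 else 0))"
    using spline_correction[OF f b(1), of q] by blast
  \<comment> \<open>The constant D(0) makes the error of order q vanish at 0; the error of order q +
    1 then bounds it by e|x|.\<close>
  obtain b' where b': "finite {i. b' i \<noteq> 0}"
    "\<And>x. x \<in> {-1<..<1} \<Longrightarrow> G b' q x = G b q x + (\<Sum>i<q. w i * (if a i < x then 1 else 0)) + D 0"
    "\<And>q' x. q' > q \<Longrightarrow> x \<in> {-1<..<1} \<Longrightarrow> G b' q' x = G b q' x"
    using add_spline[OF b(1), of q w "\<lambda>_. D 0" 0] by (auto simp: tpw_def)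
  have deriv: "(D has_real_derivative (deriv ^^ Suc q) f x - G b (Suc q) x) (at x)"
    if x: "x \<in> U (Suc q)" for x
  proof -
    have H: "((\<lambda>x. if a i < x then 1 else 0) has_real_derivative 0) (at x)" if "i < q" for i
    proof -
      have "((\<lambda>x. E (prod_encode (Suc i, q - Suc i)) q x) has_real_derivative
          E (prod_encode (Suc i, q - Suc i)) (Suc q) x) (at x)"
        using x by (intro E_has_derivative) (auto simp: U_def)
      then show ?thesis using that by (simp add: E_step E_step_higher)
    qed
    have "((\<lambda>x. (deriv ^^ q) f x - G b q x - (\<Sum>i<q. w i * (if a i < x then 1 else 0)))
        has_real_derivative (deriv ^^ Suc q) f x - G b (Suc q) x - (\<Sum>i<q. w i * 0)) (at x)"
      by (intro DERIV_diff DERIV_sum DERIV_cmult V_has_derivative[OF f x] G_has_derivative[OF sb x] H) auto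
    then have *: "((\<lambda>x. (deriv ^^ q) f x - G b q x - (\<Sum>i<q. w i * (if a i < x then 1 else 0)))
        has_real_derivative (deriv ^^ Suc q) f x - G b (Suc q) x) (at x)" by simp
    show ?thesis
      by (rule has_field_derivative_transform_within_open[OF * open_U[of q]])
         (use x U_antimono[of q "Suc q"] D(2) in auto)
  qed
  have bound: "\<bar>D v - D u\<bar> \<le> e * (v - u)" if "- \<rho> \<le> u" "u \<le> v" "v \<le> \<rho>" for u v
  proof (rule abs_diff_le_derivative_off_finite[where S = "a ` {..<Suc q}"])
    show "continuous_on {u..v} D" using that \<rho> by (intro continuous_on_subset[OF D(1)]) auto
    fix x assume "x \<in> {u<..<v} - a ` {..<Suc q}"
    then have "x \<in> U (Suc q)" "x \<in> {-\<rho>..\<rho>}" using that \<rho> by (auto simp: U_def)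
    then show "(D has_real_derivative (deriv ^^ Suc q) f x - G b (Suc q) x) (at x) \<and>
        \<bar>(deriv ^^ Suc q) f x - G b (Suc q) x\<bar> \<le> e"
      using deriv[of x] b(2)[of "Suc q" x] step.hyps by auto
  qed (use that e in auto)
  have D0: "\<bar>D x - D 0\<bar> \<le> e" if "x \<in> {-\<rho>..\<rho>}" for x
  proof -
    have "\<bar>D x - D 0\<bar> \<le> e * \<bar>x\<bar>"
      using bound[of 0 x] bound[of x 0] that \<rho> by (cases "x \<ge> 0") (auto simp: abs_minus_commute)
    also have "\<dots> \<le> e * 1" using that \<rho> e by (intro mult_left_mono) auto
    finally show ?thesis by simp
  qed
  have "\<bar>(deriv ^^ q') f x - G b' q' x\<bar> \<le> e" if "q \<le> q'" "q' \<le> p" "x \<in> {-\<rho>..\<rho>} \<inter> U q'" for q' x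
  proof (cases "q' = q")
    case True
    have "x \<in> {-1<..<1}" using that by (auto simp: U_def)
    then have "(deriv ^^ q) f x - G b' q x = D x - D 0"
      using D(2)[of x] b'(2)[of x] that True by simp
    then show ?thesis using D0[of x] that True by auto
  next
    case False
    then show ?thesis using that b(2)[of q' x] b'(3)[of q' x] by (auto simp: U_def)
  qed
  then show ?case using b'(1) by blast
qed

lemma spline_approximation:
  assumes "f \<in> V_space a" "0 < \<rho>" "\<rho> < 1" "e > 0"
  obtains b where "finite {i. b i \<noteq> 0}"
    "\<And>q x. q \<le> p \<Longrightarrow> x \<in> {-\<rho>..\<rho>} \<Longrightarrow> x \<in> U q \<Longrightarrow> \<bar>(deriv ^^ q) f x - G b q x\<bar> \<le> e"
  using spline_approximation_from[OF assms, of 0 p] by auto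

lemma abs_G_le:
  assumes "summable (\<lambda>i. \<bar>c i\<bar>)" "x \<in> {-1<..<1}"
  shows "\<bar>G c q x\<bar> \<le> 2 * suminf (\<lambda>i. \<bar>c i\<bar>)"
proof -
  have s: "summable (\<lambda>i. norm (c i * E i q x))"
    by (rule summable_comparison_test'[OF summable_mult[OF assms(1), of 2], of 0])
       (use norm_term_le[OF assms(2)] in auto)
  have "\<bar>G c q x\<bar> \<le> suminf (\<lambda>i. norm (c i * E i q x))"
    unfolding G_def using summable_norm[OF s] by simp
  also have "\<dots> \<le> suminf (\<lambda>i. 2 * \<bar>c i\<bar>)"
    using norm_term_le(1)[OF assms(2)] by (intro suminf_le s summable_mult assms(1)) auto
  also have "\<dots> = 2 * suminf (\<lambda>i. \<bar>c i\<bar>)"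
    by (rule suminf_mult[OF assms(1)])
  finally show ?thesis .
qed

text \<open>The \<open>Sup\<close> in \<open>V_seminorm\<close> can be worked with only if the set
  is bounded above. A spline at distance 1 provides a bound.\<close>

lemma V_deriv_bounded:
  assumes f: "f \<in> V_space a" and \<rho>: "0 < \<rho>" "\<rho> < 1"
  shows "\<exists>M. \<forall>q\<le>p. \<forall>x\<in>{-\<rho>..\<rho>} - range a. \<bar>(deriv ^^ q) f x\<bar> \<le> M"
proof -
  obtain b where b: "finite {i. b i \<noteq> 0}"
    "\<And>q x. q \<le> p \<Longrightarrow> x \<in> {-\<rho>..\<rho>} \<Longrightarrow> x \<in> U q \<Longrightarrow> \<bar>(deriv ^^ q) f x - G b q x\<bar> \<le> 1"
    using spline_approximation[OF f \<rho>, of 1] by auto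
  have "\<bar>(deriv ^^ q) f x\<bar> \<le> 1 + 2 * suminf (\<lambda>i. \<bar>b i\<bar>)" if "q \<le> p" "x \<in> {-\<rho>..\<rho>} - range a" for q x
  proof -
    have "x \<in> {-1<..<1} - range a" using that \<rho> by auto
    then show ?thesis
      using b(2)[of q x] not_range_in_U[of x q] abs_G_le[OF summable_finite_support[OF b(1)], of x q] that
      by auto
  qed
  then show ?thesis by blast
qed

end

subsection \<open>Algebraic relations between jets\<close>

text \<open>
  The coefficient number \<open>l\<close> is kept away from 0 so that the condition on \<open>y\<close> is closed.
\<close>

definition algebraic_relation ::
    "(nat \<Rightarrow> real) \<Rightarrow> nat list \<Rightarrow> pexp list \<times> nat \<times> nat \<Rightarrow> nat \<Rightarrow> (nat \<Rightarrow> real) \<Rightarrow> bool" where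
  "algebraic_relation d J = (\<lambda>(es, l, m) v y. (\<forall>e\<in>set es. pvars e \<subseteq> set J) \<and> l < length es \<and>
     1 / real (Suc m) \<le> \<bar>peval d (es ! l) y\<bar> \<and> (\<Sum>s<length es. peval d (es ! s) y * y v ^ s) = 0)"

text \<open>Algebraicity becomes a union of closed conditions over the countable type of the data
  (es, l, m); the Archimedean property supplies m.\<close>

lemma acl_iff_algebraic_relation:
  "y v \<in> acl (range d \<union> y ` set J) \<longleftrightarrow> (\<exists>r. algebraic_relation d J r v y)"
proof
  assume "y v \<in> acl (range d \<union> y ` set J)"
  then obtain p where p: "p \<noteq> 0" "\<And>i. coeff p i \<in> generate_ring RR (range d \<union> y ` set J)" "poly p (y v) = 0"
    unfolding acl_iff by blast
  obtain e where e: "\<And>i. pvars (e i) \<subseteq> set J" "\<And>i. coeff p i = peval d (e i) y"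
    using generate_ring_imp_peval[OF p(2)] by metis
  let ?n = "Polynomial.degree p"
  obtain m where m: "1 / real (Suc m) < \<bar>coeff p ?n\<bar>"
    using p(1) reals_Archimedean[of "\<bar>coeff p ?n\<bar>"] by (auto simp: inverse_eq_divide)
  have "(\<Sum>s<Suc ?n. peval d (e s) y * y v ^ s) = 0"
    using p(3) unfolding poly_altdef e(2) lessThan_Suc_atMost .
  moreover have "(\<Sum>s<Suc ?n. peval d (map e [0..<Suc ?n] ! s) y * y v ^ s) = (\<Sum>s<Suc ?n. peval d (e s) y * y v ^ s)"
    by (rule sum.cong) (auto simp del: upt_Suc)
  ultimately have "algebraic_relation d J (map e [0..<Suc ?n], ?n, m) v y"
    using m e by (auto simp: algebraic_relation_def simp del: upt_Suc)
  then show "\<exists>r. algebraic_relation d J r v y" ..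
next
  assume "\<exists>r. algebraic_relation d J r v y"
  then obtain es l m where "algebraic_relation d J (es, l, m) v y" by (metis prod_cases3)
  then have r: "\<And>e. e \<in> set es \<Longrightarrow> pvars e \<subseteq> set J" "l < length es"
     "1 / real (Suc m) \<le> \<bar>peval d (es ! l) y\<bar>" "(\<Sum>s<length es. peval d (es ! s) y * y v ^ s) = 0"
    by (auto simp: algebraic_relation_def)
  define p where "p = (\<Sum>s<length es. Polynomial.monom (peval d (es ! s) y) s)"
  have c: "coeff p i = (if i < length es then peval d (es ! i) y else 0)" for i
    by (simp add: p_def coeff_sum sum.delta)
  have "0 < 1 / real (Suc m)" by simp
  then have "peval d (es ! l) y \<noteq> 0" using r(3) by linarith
  then have "p \<noteq> 0" using c[of l] r(2) by auto
  moreover have "coeff p i \<in> generate_ring RR (range d \<union> y ` set J)" for i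
    using r(1)[OF nth_mem[of i es]] by (auto simp: c intro: peval_in_generate_ring generate_ring_closed)
  moreover have "poly p (y v) = 0"
    using r(4) by (simp add: p_def poly_sum poly_monom)
  ultimately show "y v \<in> acl (range d \<union> y ` set J)" unfolding acl_iff by blast
qed

lemma continuous_on_peval:
  assumes "\<And>v. continuous_on S (\<lambda>z. y z v)"
  shows "continuous_on S (\<lambda>z. peval d e (y z))"
  using assms by (induction e) (auto intro!: continuous_intros)

lemma closed_algebraic_relation:
  fixes y :: "'a::topological_space \<Rightarrow> nat \<Rightarrow> real"
  assumes "closed S" "\<And>v. continuous_on S (\<lambda>z. y z v)"
  shows "closed {z \<in> S. algebraic_relation d J r v (y z)}"
proof -
  obtain es l m where r: "r = (es, l, m)" by (cases r)
  note cont = continuous_on_peval[of S y, OF assms(2)]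
  have 1: "closed (S \<inter> (\<lambda>z. \<bar>peval d (es ! l) (y z)\<bar>) -` {1 / real (Suc m)..})"
    by (intro continuous_closed_preimage continuous_intros cont assms(1))
  have 2: "closed (S \<inter> (\<lambda>z. \<Sum>s<length es. peval d (es ! s) (y z) * y z v ^ s) -` {0})"
    by (intro continuous_closed_preimage continuous_intros cont assms)
  have "{z \<in> S. algebraic_relation d J r v (y z)} =
    (if (\<forall>e\<in>set es. pvars e \<subseteq> set J) \<and> l < length es then
      (S \<inter> (\<lambda>z. \<bar>peval d (es ! l) (y z)\<bar>) -` {1 / real (Suc m)..}) \<inter>
      (S \<inter> (\<lambda>z. \<Sum>s<length es. peval d (es ! s) (y z) * y z v ^ s) -` {0}) else {})"
    by (auto simp: algebraic_relation_def r)
  then show ?thesis using closed_Int[OF 1 2] by simp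
qed

lemma set_double_comprehension:
  "set [h i q. i \<leftarrow> [0..<n], q \<leftarrow> [l i..<u i]] = {h i q | i q. i < n \<and> l i \<le> q \<and> q < u i}"
  by (auto; blast)

lemma compact_box:
  fixes l u :: "nat \<Rightarrow> real"
  shows "compact {x. \<forall>i. l i \<le> x i \<and> x i \<le> u i}"
proof -
  have "{x. \<forall>i. l i \<le> x i \<and> x i \<le> u i} = PiE UNIV (\<lambda>i. {l i..u i})" by (auto simp: PiE_def)
  moreover have "compactin (product_topology (\<lambda>i. euclidean) UNIV) (PiE UNIV (\<lambda>i. {l i..u i}))"
    by (auto simp: compactin_PiE)
  ultimately show ?thesis by (simp add: euclidean_product_topology)
qed

section \<open>Jet coordinates and a compact exhaustion of the tuples\<close>

context singular_points
begin

text \<open>The points followed by the entries of \<open>jet_tuple\<close> in the same order, but as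
  functions of the pair (c, x). The points \<open>a i\<close> are left out, as they belong to the
  base field.\<close>

definition coord_funs :: "nat \<Rightarrow> nat \<Rightarrow> nat \<Rightarrow> ((nat \<Rightarrow> real) \<times> (nat \<Rightarrow> real) \<Rightarrow> real) list" where
  "coord_funs n p k =
     [\<lambda>(c, x). x i. i \<leftarrow> [0..<n]] @
     [\<lambda>(c, x). G c q (x i). i \<leftarrow> [0..<n], q \<leftarrow> [0..<Suc p]] @
     [\<lambda>(c, x). G c q (a i). i \<leftarrow> [0..<Suc k], q \<leftarrow> [0..<Suc i]] @
     [\<lambda>(c, x). G c q (a i). i \<leftarrow> [0..<Suc k], q \<leftarrow> [Suc i..<Suc p]] @
     [\<lambda>(c, x). Gr c q (a i). i \<leftarrow> [0..<Suc k], q \<leftarrow> [Suc i..<Suc p]]"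

lemma set_coord_funs:
  "set (coord_funs n p k) = {\<lambda>(c, x). x i | i. i < n} \<union> {\<lambda>(c, x). G c q (x i) | i q. i < n \<and> 0 \<le> q \<and> q < Suc p} \<union>
    {\<lambda>(c, x). G c q (a i) | i q. i < Suc k \<and> 0 \<le> q \<and> q < Suc i} \<union>
    {\<lambda>(c, x). G c q (a i) | i q. i < Suc k \<and> Suc i \<le> q \<and> q < Suc p} \<union>
    {\<lambda>(c, x). Gr c q (a i) | i q. i < Suc k \<and> Suc i \<le> q \<and> q < Suc p}"
proof -
  have *: "set (map h [0..<n]) = {h i | i. i < n}" for h :: "nat \<Rightarrow> 'b"
    by auto
  show ?thesis
    unfolding coord_funs_def set_append set_double_comprehension * Un_assoc ..
qed

lemma map_coord_funs:
  assumes c: "summable (\<lambda>i. \<bar>c i\<bar>)" and x: "\<And>i. i < n \<Longrightarrow> x i \<in> {-1<..<1} - range a"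
  shows "map (\<lambda>\<phi>. \<phi> (c, x)) (coord_funs n p k) = map x [0..<n] @ jet_tuple a p k (gfun c) (map x [0..<n])"
proof -
  have 1: "G c q (x i) = (deriv ^^ q) (gfun c) (x i)" if "i < n" for i q
    using deriv_gfun[OF c] not_range_in_U[OF x[OF that]] by simp
  have 2: "G c q (a i) = (deriv ^^ q) (gfun c) (a i)" if "q \<le> i" for i q
    using deriv_gfun[OF c] a_in_U[OF that] by simp
  have ai: "a i \<in> {-1<..<1}" for i using a_bounds[of i] by simp
  show ?thesis
    unfolding coord_funs_def jet_tuple_def
    using left_nth_deriv_gfun[OF c ai] right_nth_deriv_gfun[OF c ai]
    by (simp add: map_concat comp_def del: upt_Suc)
       (intro arg_cong2[where f = "(@)"] arg_cong[where f = concat] map_cong refl; simp add: 1 2 del: upt_Suc)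
qed

text \<open>Padded with 0 to a total sequence, as \<open>peval\<close> expects.\<close>

definition coords :: "nat \<Rightarrow> nat \<Rightarrow> nat \<Rightarrow> (nat \<Rightarrow> real) \<times> (nat \<Rightarrow> real) \<Rightarrow> nat \<Rightarrow> real" where
  "coords n p k z v = (if v < length (coord_funs n p k) then (coord_funs n p k ! v) z else 0)"

lemma coords_image: "coords n p k z ` {..<length (coord_funs n p k)} = set (map (\<lambda>\<phi>. \<phi> z) (coord_funs n p k))"
  unfolding set_map set_conv_nth by (force simp: coords_def)

text \<open>Compact pieces, indexed by r, that exhaust the admissible tuples. Only a_0, ..., a_p are
  kept at a distance: orders up to p need no more, and no point has positive distance from a dense
  S. The zeros beyond n make the piece compact in the space of sequences.\<close>

definition tuples :: "nat \<Rightarrow> nat \<Rightarrow> nat \<Rightarrow> (nat \<Rightarrow> real) set" where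
  "tuples n p r = {x. (\<forall>i<n. \<bar>x i\<bar> \<le> 1 - 1 / real (Suc r)) \<and>
     (\<forall>i<n. \<forall>j<n. i \<noteq> j \<longrightarrow> 1 / real (Suc r) \<le> \<bar>x i - x j\<bar>) \<and>
     (\<forall>i<n. \<forall>l\<le>p. 1 / real (Suc r) \<le> \<bar>x i - a l\<bar>) \<and> (\<forall>i\<ge>n. x i = 0)}"

lemma tuples_in_U: "x \<in> tuples n p r \<Longrightarrow> i < n \<Longrightarrow> q \<le> Suc p \<Longrightarrow> x i \<in> U q"
proof -
  assume x: "x \<in> tuples n p r" "i < n" "q \<le> Suc p"
  have r: "0 < 1 / real (Suc r)" by simp
  have "\<bar>x i\<bar> \<le> 1 - 1 / real (Suc r)" using x by (simp add: tuples_def)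
  then have "\<bar>x i\<bar> < 1" using r by linarith
  moreover have "x i \<noteq> a l" if "l < q" for l
  proof -
    have "l \<le> p" using that x by simp
    then have "1 / real (Suc r) \<le> \<bar>x i - a l\<bar>" using x by (auto simp: tuples_def)
    then show ?thesis using r by auto
  qed
  ultimately show "x i \<in> U q" by (auto simp: U_def)
qed

lemma tuples_distinct: "x \<in> tuples n p r \<Longrightarrow> inj_on x {..<n}"
proof (rule inj_onI, rule ccontr)
  fix i j assume *: "x \<in> tuples n p r" "i \<in> {..<n}" "j \<in> {..<n}" "x i = x j" "i \<noteq> j"
  then have "1 / real (Suc r) \<le> \<bar>x i - x j\<bar>" unfolding tuples_def by blast
  moreover have "0 < 1 / real (Suc r)" by simp
  ultimately show False using * by simp
qed

lemma compact_tuples: "compact (tuples n p r)"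
proof -
  let ?B = "{x. \<forall>i. (if i < n then - 1 else 0) \<le> x i \<and> x i \<le> (if i < n then 1 else (0::real))}"
  let ?C = "{x. (\<forall>i<n. \<bar>x i\<bar> \<le> 1 - 1 / real (Suc r)) \<and>
     (\<forall>i<n. \<forall>j<n. i \<noteq> j \<longrightarrow> 1 / real (Suc r) \<le> \<bar>x i - x j\<bar>) \<and>
     (\<forall>i<n. \<forall>l\<le>p. 1 / real (Suc r) \<le> \<bar>x i - a l\<bar>)}"
  have "closed ?C"
    by (intro closed_Collect_conj closed_Collect_all closed_Collect_imp closed_Collect_le continuous_intros) auto
  then have "compact (?B \<inter> ?C)" using compact_box by (intro compact_Int_closed) auto
  moreover have "tuples n p r = ?B \<inter> ?C"
  proof (intro equalityI subsetI IntI)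
    fix x assume x: "x \<in> tuples n p r"
    show "x \<in> ?C" using x by (auto simp: tuples_def)
    have "\<bar>x i\<bar> \<le> 1" if "i < n" for i
    proof -
      have "\<bar>x i\<bar> \<le> 1 - 1 / real (Suc r)" using x that by (auto simp: tuples_def)
      moreover have "0 < 1 / real (Suc r)" by simp
      ultimately show ?thesis by linarith
    qed
    then show "x \<in> ?B" using x by (auto simp: tuples_def abs_le_iff)
  next
    fix x assume "x \<in> ?B \<inter> ?C"
    then have C: "x \<in> ?C" and B: "x \<in> ?B" by (rule IntD2, rule IntD1)
    have "x i = 0" if "i \<ge> n" for i
    proof -
      show ?thesis using B[unfolded mem_Collect_eq, rule_format, of i] that by simp
    qed
    then show "x \<in> tuples n p r" using C by (simp add: tuples_def)
  qed
  ultimately show ?thesis by simp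
qed

lemma exists_tuples:
  assumes "inj_on x {..<n}" "\<And>i. i < n \<Longrightarrow> x i \<in> {-1<..<1} - range a" "\<And>i. i \<ge> n \<Longrightarrow> x i = 0"
  shows "\<exists>r. x \<in> tuples n p r"
proof -
  have lim: "(\<lambda>r. 1 / real (Suc r)) \<longlonglongrightarrow> 0"
    using LIMSEQ_inverse_real_of_nat by (simp add: inverse_eq_divide)
  have small: "eventually (\<lambda>r. 1 / real (Suc r) \<le> t) sequentially" if "t > 0" for t
    using order_tendstoD(2)[OF lim that] by (rule eventually_mono) simp
  have "eventually (\<lambda>r. \<forall>i\<in>{..<n}. 1 / real (Suc r) \<le> 1 - \<bar>x i\<bar>) sequentially"
    using assms(2) by (intro eventually_ball_finite ballI small) (auto simp: abs_less_iff)
  moreover have "eventually (\<lambda>r. \<forall>(i, j)\<in>{(i, j). i < n \<and> j < n \<and> i \<noteq> j}. 1 / real (Suc r) \<le> \<bar>x i - x j\<bar>) sequentially"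
  proof (intro eventually_ball_finite ballI)
    show "finite {(i, j). i < n \<and> j < n \<and> i \<noteq> j}"
      by (rule finite_subset[of _ "{..<n} \<times> {..<n}"]) auto
    fix z assume "z \<in> {(i, j). i < n \<and> j < n \<and> i \<noteq> j}"
    then show "eventually (\<lambda>r. case z of (i, j) \<Rightarrow> 1 / real (Suc r) \<le> \<bar>x i - x j\<bar>) sequentially"
      using assms(1) by (auto intro!: small simp: inj_on_def simp del: of_nat_Suc)
  qed
  moreover have "eventually (\<lambda>r. \<forall>(i, l)\<in>{..<n} \<times> {..p}. 1 / real (Suc r) \<le> \<bar>x i - a l\<bar>) sequentially"
  proof (intro eventually_ball_finite ballI)
    fix z assume "z \<in> {..<n} \<times> {..p}"
    then show "eventually (\<lambda>r. case z of (i, l) \<Rightarrow> 1 / real (Suc r) \<le> \<bar>x i - a l\<bar>) sequentially"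
      using assms(2) by (auto intro!: small simp del: of_nat_Suc) (metis rangeI)
  qed auto
  ultimately have "eventually (\<lambda>r. x \<in> tuples n p r) sequentially"
    by eventually_elim (use assms(3) in \<open>auto simp: tuples_def algebra_simps\<close>)
  then show ?thesis by (auto simp: eventually_sequentially)
qed

end

lemma higher_pderiv_monom_fact:
  "(pderiv ^^ q) (Polynomial.monom (1 / fact s) s) =
    (if q \<le> s then Polynomial.monom (1 / fact (s - q)) (s - q) else (0 :: real poly))"
proof (induction q)
  case (Suc q)
  consider "Suc q \<le> s" | "q = s" | "q > s" by linarith
  then show ?case
  proof cases
    case 1
    then obtain m where m: "s - q = Suc m" "s - Suc q = m" by (metis Suc_diff_Suc Suc_le_lessD)
    have "real (Suc m) * (1 / fact (Suc m)) = 1 / fact m" by (simp add: divide_simps)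
    then show ?thesis using 1 Suc m by (simp add: pderiv_monom del: of_nat_Suc fact_Suc)
  qed (use Suc in \<open>simp_all add: pderiv_monom\<close>)
qed simp

lemma poly_higher_pderiv_monom_fact: "poly ((pderiv ^^ q) (Polynomial.monom (1 / fact s) s)) z = tpw s q z"
  by (simp add: higher_pderiv_monom_fact tpw_def poly_monom)

lemma tendsto_fun_nat:
  fixes f :: "'b \<Rightarrow> nat \<Rightarrow> real"
  assumes "\<And>i. ((\<lambda>n. f n i) \<longlongrightarrow> c i) F"
  shows "(f \<longlongrightarrow> c) F"
proof -
  have "limitin (product_topology (\<lambda>i. euclidean) UNIV) f c F"
    using assms by (simp add: limitin_componentwise)
  then show ?thesis by (simp add: euclidean_product_topology)
qed

text \<open>One summable majorant for all c in P makes the series converge uniformly in c and x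
  together, and each partial sum involves finitely many coordinates of c.\<close>

lemma continuous_on_coefficient_series:
  fixes e :: "nat \<Rightarrow> 'b::topological_space \<Rightarrow> real"
  assumes M: "\<forall>c\<in>P. \<forall>i. \<bar>c i\<bar> \<le> M i" "summable M"
    and e: "\<And>i x. x \<in> W \<Longrightarrow> \<bar>e i x\<bar> \<le> 2" "\<And>i. continuous_on W (e i)"
  shows "continuous_on (P \<times> W) (\<lambda>(c, x). suminf (\<lambda>i. c i * e i x))"
proof (rule uniform_limit_theorem[of _ _ sequentially])
  have bound: "norm (c i * e i x) \<le> M i * 2" if "c \<in> P" "x \<in> W" for c i x
  proof -
    have "\<bar>c i\<bar> \<le> M i" using M(1) that by blast
    then show ?thesis unfolding norm_mult using that e(1)[of x i] by (intro mult_mono) auto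
  qed
  show "uniform_limit (P \<times> W) (\<lambda>n z. \<Sum>i<n. case z of (c, x) \<Rightarrow> c i * e i x)
      (\<lambda>(c, x). suminf (\<lambda>i. c i * e i x)) sequentially"
  proof -
    have "uniform_limit (P \<times> W) (\<lambda>n z. \<Sum>i<n. case z of (c, x) \<Rightarrow> c i * e i x)
        (\<lambda>z. suminf (\<lambda>i. case z of (c, x) \<Rightarrow> c i * e i x)) sequentially"
      by (rule Weierstrass_m_test[OF _ summable_mult2[OF M(2)]]) (use bound in auto)
    then show ?thesis by (simp add: case_prod_unfold)
  qed
  have "continuous_on (P \<times> W) (\<lambda>z. \<Sum>i<n. fst z i * e i (snd z))" for n
    by (intro continuous_intros continuous_on_product_then_coordinatewise[OF continuous_on_fst[OF continuous_on_id]]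
        continuous_on_compose2[OF e(2) continuous_on_snd[OF continuous_on_id]]) auto
  then show "\<forall>\<^sub>F n in sequentially. continuous_on (P \<times> W) (\<lambda>z. \<Sum>i<n. case z of (c, x) \<Rightarrow> c i * e i x)"
    by (simp add: case_prod_unfold)
qed simp

section \<open>Counting coefficients and recovering them from jets\<close>

context singular_points
begin

text \<open>
  The indices of the coefficients that the jets determine once all others are known.
\<close>

definition need :: "nat \<Rightarrow> nat \<Rightarrow> nat \<Rightarrow> nat set" where
  "need n p k = prod_encode ` ((\<Union>i\<le>k. {Suc i} \<times> {..<p - i}) \<union> {0} \<times> {..<(n + Suc k) * Suc p})"

text \<open>For k \<le> p this is also the length of the jet tuple: each of the n points contributes
  p + 1 values, and \<open>a i\<close> contributes p + 1 values or left limits and p - i right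
  limits.\<close>

lemma card_need: "card (need n p k) = (\<Sum>i\<le>k. p - i) + (n + Suc k) * Suc p"
proof -
  have "card (need n p k) = card ((\<Union>i\<le>k. {Suc i} \<times> {..<p - i}) \<union> {0::nat} \<times> {..<(n + Suc k) * Suc p})"
    unfolding need_def by (rule card_image) (rule inj_prod_encode)
  also have "\<dots> = card (\<Union>i\<le>k. {Suc i} \<times> {..<p - i}) + card ({0::nat} \<times> {..<(n + Suc k) * Suc p})"
    by (rule card_Un_disjoint) auto
  also have "card (\<Union>i\<le>k. {Suc i} \<times> {..<p - i}) = (\<Sum>i\<le>k. card ({Suc i} \<times> {..<p - i}))"
    by (rule card_UN_disjoint) auto
  finally show ?thesis by (simp only: card_cartesian_product) simp
qed

lemma finite_need: "finite (need n p k)"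
  by (simp add: need_def)

lemma coord_fun_values:
  fixes c x :: "nat \<Rightarrow> real" and n p k :: nat
  defines "Z \<equiv> set (map (\<lambda>\<phi>. \<phi> (c, x)) (coord_funs n p k))"
  shows "i < n \<Longrightarrow> x i \<in> Z" "i < n \<Longrightarrow> q \<le> p \<Longrightarrow> G c q (x i) \<in> Z"
    "i \<le> k \<Longrightarrow> q \<le> p \<Longrightarrow> G c q (a i) \<in> Z" "i \<le> k \<Longrightarrow> i < q \<Longrightarrow> q \<le> p \<Longrightarrow> Gr c q (a i) \<in> Z"
proof -
  have Z: "\<phi> (c, x) \<in> Z" if "\<phi> \<in> set (coord_funs n p k)" for \<phi>
    using that by (auto simp: Z_def)
  show "x i \<in> Z" if "i < n"
  proof -
    have "(\<lambda>(c, x). x i) \<in> set (coord_funs n p k)" using that unfolding set_coord_funs by blast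
    from Z[OF this] show ?thesis by simp
  qed
  show "G c q (x i) \<in> Z" if "i < n" "q \<le> p"
  proof -
    have "0 \<le> q" "q < Suc p" using that by auto
    then have "(\<lambda>(c, x). G c q (x i)) \<in> set (coord_funs n p k)"
      using that(1) unfolding set_coord_funs by blast
    from Z[OF this] show ?thesis by simp
  qed
  show "G c q (a i) \<in> Z" if "i \<le> k" "q \<le> p"
  proof -
    have "i < Suc k" "0 \<le> q" "q < Suc p" "q < Suc i \<or> Suc i \<le> q" using that by auto
    then have "(\<lambda>(c, x). G c q (a i)) \<in> set (coord_funs n p k)"
      unfolding set_coord_funs by blast
    from Z[OF this] show ?thesis by simp
  qed
  show "Gr c q (a i) \<in> Z" if "i \<le> k" "i < q" "q \<le> p"
  proof -
    have "i < Suc k" "Suc i \<le> q" "q < Suc p" using that by auto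
    then have "(\<lambda>(c, x). Gr c q (a i)) \<in> set (coord_funs n p k)"
      unfolding set_coord_funs by blast
    from Z[OF this] show ?thesis by simp
  qed
qed

lemma E_mem:
  assumes "real_subfield K" "range a \<subseteq> K" "z \<in> K"
  shows "E j q z \<in> K"
proof -
  interpret real_subfield K by fact
  have "center i \<in> K" for i using assms(2) by (cases i) auto
  moreover have "fact m \<in> K" for m using of_nat[of "fact m"] by simp
  ultimately show ?thesis
    using assms(3) by (auto simp: E_def trunc_def tpw_def intro!: divide power diff)
qed

text \<open>Basis functions centred at \<open>a i\<close> jump there in different orders, and by
  injectivity of \<open>a\<close> no other one is singular there; so a jump isolates a single
  coefficient.\<close>

lemma E_jump:
  "Er j q (a i) - E j q (a i) = (if i < q \<and> j = prod_encode (Suc i, q - Suc i) then 1 else 0)"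
proof -
  obtain j1 m where j: "j = prod_encode (j1, m)" by (metis prod_decode_inverse surj_pair)
  show ?thesis
  proof (cases "j1 = Suc i")
    case True
    then show ?thesis
      using rtrunc_minus_trunc[of j1 "a i" m q] by (auto simp: j E_def Er_def prod_encode_eq)
  next
    case False
    then have "a i \<noteq> center j1 \<or> j1 = 0" using inj_a by (cases j1) (auto simp: inj_def)
    then have "rtrunc j1 m q (a i) = trunc j1 m q (a i)" by (intro rtrunc_eq_trunc) auto
    then show ?thesis using False by (auto simp: j E_def Er_def prod_encode_eq)
  qed
qed

text \<open>
  The jumps at the singular points give the coefficients of the truncated powers, and what remains
  at the \<open>n + k + 1\<close> points is a Hermite interpolation problem for the polynomial part.
\<close>

lemma coefficients_from_jets:
  fixes c x :: "nat \<Rightarrow> real" and n p k :: nat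
  assumes c0: "\<And>i. i \<ge> M \<Longrightarrow> c i = 0" and x: "x \<in> tuples n p r" and k: "k \<le> p"
  defines "Z \<equiv> set (map (\<lambda>\<phi>. \<phi> (c, x)) (coord_funs n p k))"
  shows "c i \<in> acl (range a \<union> (Z \<union> c ` ({..<M} - need n p k)))"
proof -
  define K where "K = acl (range a \<union> (Z \<union> c ` ({..<M} - need n p k)))"
  interpret real_subfield K unfolding K_def by (rule real_subfield_acl)
  have sub: "range a \<union> (Z \<union> c ` ({..<M} - need n p k)) \<subseteq> K" unfolding K_def by (rule subset_acl)
  define S where "S = (n + Suc k) * Suc p"
  note Zmem = coord_fun_values(1,2)[where c = c and x = x and n = n and p = p and k = k, folded Z_def]
  note ZGa = coord_fun_values(3)[where c = c and x = x and n = n and p = p and k = k, folded Z_def]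
  note ZGr = coord_fun_values(4)[where c = c and x = x and n = n and p = p and k = k, folded Z_def]
  have c0': "c j = 0" if "{..<M} \<subseteq> N" "j \<notin> N" for j N
    using that by (intro c0) (meson lessThan_iff not_less subsetD)
  have finG: "G c q z = (\<Sum>j\<in>N. c j * E j q z)" if "finite N" "{..<M} \<subseteq> N" for N q z
    unfolding G_def using that c0'[of N] by (intro suminf_finite) auto
  have finGr: "Gr c q z = (\<Sum>j\<in>N. c j * Er j q z)" if "finite N" "{..<M} \<subseteq> N" for N q z
    unfolding Gr_def using that c0'[of N] by (intro suminf_finite) auto
  have jump: "c (prod_encode (Suc i, m)) \<in> K" if "i \<le> k" "m < p - i" for i m
  proof -
    let ?q = "Suc i + m" and ?j = "prod_encode (Suc i, m)"
    \<comment> \<open>The index \<open>?j\<close> may lie beyond M; adding it to the range of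
      summation covers both cases.\<close>
    let ?N = "insert ?j {..<M}"
    have "Gr c ?q (a i) - G c ?q (a i) = (\<Sum>j\<in>?N. c j * (Er j ?q (a i) - E j ?q (a i)))"
      by (subst (1) finGr[of ?N], simp, blast, subst finG[of ?N], simp, blast)
         (simp only: right_diff_distrib sum_subtractf)
    also have "\<dots> = (\<Sum>j\<in>?N. if j = ?j then c j else 0)"
      unfolding E_jump by (intro sum.cong) auto
    also have "\<dots> = c ?j"
      by (simp add: sum.delta)
    finally have "c ?j = Gr c ?q (a i) - G c ?q (a i)" ..
    moreover have "Gr c ?q (a i) \<in> K" "G c ?q (a i) \<in> K"
      using ZGr[of i ?q] ZGa[of i ?q] that sub by auto
    ultimately show ?thesis by (simp add: diff)
  qed
  define I0 where "I0 = (\<lambda>s. prod_encode (0, s)) ` {..<S}"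
  \<comment> \<open>Such a coefficient is read off from a jump, is among the given ones, or is 0
    because its index is at least M.\<close>
  have others: "c j \<in> K" if j: "j \<notin> I0" for j
  proof (cases "j < M \<and> j \<in> need n p k")
    case True
    moreover have "need n p k = prod_encode ` ((\<Union>i\<le>k. {Suc i} \<times> {..<p - i}) \<union> {0} \<times> {..<S})"
      by (simp only: need_def S_def)
    ultimately obtain i m where "i \<le> k" "m < p - i" "j = prod_encode (Suc i, m)"
      using j by (auto simp: I0_def)
    then show ?thesis using jump by simp
  next
    case False
    then show ?thesis using sub c0[of j] by (cases "j < M") auto
  qed
  \<comment> \<open>The remaining unknowns form a polynomial of degree below S = (n + k + 1)(p + 1),
    which is the number of Hermite conditions.\<close>
  define Q where "Q = (\<Sum>s<S. smult (c (prod_encode (0, s))) (Polynomial.monom (1 / fact s) s))"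
  have Qcoeff: "coeff Q i = (if i < S then c (prod_encode (0, i)) / fact i else 0)" for i
    by (simp add: Q_def coeff_sum sum.delta if_distrib[of "\<lambda>t. _ * t"] cong: if_cong)
  have Qder: "poly ((pderiv ^^ q) Q) z = G c q z - (\<Sum>j\<in>{..<M} - I0. c j * E j q z)" for q z
  proof -
    have "poly ((pderiv ^^ q) Q) z = (\<Sum>s<S. c (prod_encode (0, s)) * tpw s q z)"
      by (simp add: Q_def higher_pderiv_sum higher_pderiv_smult poly_sum poly_higher_pderiv_monom_fact)
    also have "\<dots> = (\<Sum>j\<in>I0. c j * E j q z)"
      unfolding I0_def by (subst sum.reindex) (auto simp: inj_on_def prod_encode_eq E_poly)
    finally have 1: "poly ((pderiv ^^ q) Q) z = (\<Sum>j\<in>I0. c j * E j q z)" .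
    have "G c q z = (\<Sum>j\<in>I0 \<union> ({..<M} - I0). c j * E j q z)"
      by (rule finG) (auto simp: I0_def)
    also have "\<dots> = (\<Sum>j\<in>I0. c j * E j q z) + (\<Sum>j\<in>{..<M} - I0. c j * E j q z)"
      by (rule sum.union_disjoint) (auto simp: I0_def)
    finally show ?thesis using 1 by simp
  qed
  define pts where "pts = x ` {..<n} \<union> a ` {..k}"
  have finite_pts: "finite pts" by (simp add: pts_def)
  have card_pts: "card pts = n + Suc k"
  proof -
    have "x i \<noteq> a l" if "i < n" "l \<le> k" for i l
      using tuples_in_U[OF x that(1), of "Suc p"] that k by (auto simp: U_def)
    then have "card pts = card (x ` {..<n}) + card (a ` {..k})"
      unfolding pts_def by (intro card_Un_disjoint) auto
    also have "\<dots> = n + Suc k"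
      using tuples_distinct[OF x] inj_a by (simp add: card_image inj_on_subset[of a UNIV])
    finally show ?thesis .
  qed
  have pts_K: "pts \<subseteq> K"
    using Zmem(1) sub by (auto simp: pts_def)
  have "coeff Q i \<in> K" for i
  proof (rule hermite_coeff_mem[OF finite_pts pts_K, of "\<lambda>_. Suc p"])
    show "coeff Q i = 0" if "(\<Sum>z\<in>pts. Suc p) \<le> i" for i
      using that by (simp add: Qcoeff card_pts S_def)
    \<comment> \<open>At \<open>a i\<close> with q > i, \<open>G\<close> is the left limit. It
      suffices, since all \<open>E j q\<close> are taken from the left too and \<open>Q\<close> does
      not jump.\<close>
    fix z q assume z: "z \<in> pts" "q < Suc p"
    have "G c q z \<in> K"
      using z Zmem(2)[of _ q] ZGa[of _ q] sub by (auto simp: pts_def less_Suc_eq_le)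
    moreover have "E j q z \<in> K" for j
      using z pts_K sub by (intro E_mem[OF real_subfield_axioms]) auto
    ultimately show "poly ((pderiv ^^ q) Q) z \<in> K"
      unfolding Qder using others by (intro diff sum mult) auto
  qed
  then have poly_part: "c (prod_encode (0, s)) \<in> K" if "s < S" for s
  proof -
    have "fact s \<in> K" using of_nat[of "fact s"] by simp
    show ?thesis
      using mult[OF \<open>\<And>i. coeff Q i \<in> K\<close>[of s] \<open>fact s \<in> K\<close>] that by (simp add: Qcoeff)
  qed
  show ?thesis
    unfolding K_def[symmetric] using others[of i] poly_part by (cases "i \<in> I0") (auto simp: I0_def)
qed

text \<open>For some x in the compact piece, the relations \<open>R\<close> make every coordinate
  algebraic over Q(S) and the coordinates listed in \<open>J\<close>. Fixing \<open>J\<close>,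
  \<open>R\<close> and r gives countably many sets, and \<open>fst\<close> projects away x.\<close>

definition bad :: "(nat \<Rightarrow> real) set \<Rightarrow> nat \<Rightarrow> nat \<Rightarrow> nat \<Rightarrow> nat \<Rightarrow> nat list \<Rightarrow> (pexp list \<times> nat \<times> nat) list \<Rightarrow>
    (nat \<Rightarrow> real) set" where
  "bad P n p k r J R = fst ` {z \<in> P \<times> tuples n p r.
     \<forall>v<length (coord_funs n p k). algebraic_relation a J (R ! v) v (coords n p k z)}"

text \<open>Otherwise the M independent coefficients would be algebraic over Q(S) and fewer than M
  numbers: those listed in \<open>J\<close> and the coefficients outside \<open>need\<close>.
  Nothing is assumed about x, which is itself one of the coordinates.\<close>

lemma generic_not_bad:
  assumes c0: "\<And>i. i \<ge> M \<Longrightarrow> c i = 0" and ind: "indep_list (range a) (map c [0..<M])"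
    and k: "k \<le> p" and need: "need n p k \<subseteq> {..<M}" and J: "card (set J) < card (need n p k)"
  shows "c \<notin> bad P n p k r J R"
proof
  assume "c \<in> bad P n p k r J R"
  then obtain x where x: "x \<in> tuples n p r"
    and rel: "\<And>v. v < length (coord_funs n p k) \<Longrightarrow> algebraic_relation a J (R ! v) v (coords n p k (c, x))"
    by (auto simp: bad_def)
  let ?Z = "set (map (\<lambda>\<phi>. \<phi> (c, x)) (coord_funs n p k))"
  let ?O = "c ` ({..<M} - need n p k)" and ?Y = "coords n p k (c, x) ` set J"
  have mono: "acl (range a \<union> ?Y) \<subseteq> acl (range a \<union> (?Y \<union> ?O))" by (rule acl_mono) auto
  have "?Z \<subseteq> acl (range a \<union> ?Y)"
    unfolding coords_image[symmetric] using rel acl_iff_algebraic_relation by blast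
  then have "range a \<union> (?Z \<union> ?O) \<subseteq> acl (range a \<union> (?Y \<union> ?O))"
    using mono subset_acl[of "range a \<union> (?Y \<union> ?O)"] by blast
  from acl_subset_acl[OF this] have "c i \<in> acl (range a \<union> (?Y \<union> ?O))" for i
    using coefficients_from_jets[where c = c and M = M and i = i, OF c0 x k] by blast
  then have "set (map c [0..<M]) \<subseteq> acl (range a \<union> (?Y \<union> ?O))" by auto
  then have "length (map c [0..<M]) \<le> card (?Y \<union> ?O)"
    by (intro steinitz_acl[OF _ ind]) auto
  also have "\<dots> \<le> card ?Y + card ?O" by (rule card_Un_le)
  also have "\<dots> \<le> card (set J) + card ({..<M} - need n p k)"
    by (intro add_mono card_image_le) auto
  also have "card ({..<M} - need n p k) = M - card (need n p k)"
    using need by (simp add: card_Diff_subset finite_need)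
  finally have "M \<le> card (set J) + (M - card (need n p k))" by simp
  moreover have "card (need n p k) \<le> M" using card_mono[OF _ need] by simp
  ultimately show False using J by simp
qed

end

subsection \<open>Generic coefficients\<close>

context singular_points
begin

lemma continuous_on_coord_funs:
  assumes M: "\<forall>c\<in>P. \<forall>i. \<bar>c i\<bar> \<le> M i" "summable M"
    and \<phi>: "\<phi> \<in> set (coord_funs n p k)"
  shows "continuous_on (P \<times> tuples n p r) \<phi>"
proof -
  note series = continuous_on_coefficient_series[OF M, where W = "tuples n p r"]
  have ai: "a i \<in> {-1<..<1}" for i using a_bounds[of i] by simp
  have coord: "continuous_on A (\<lambda>x. x i)" for A :: "(nat \<Rightarrow> real) set" and i
    by (rule continuous_on_product_then_coordinatewise[OF continuous_on_id])
  have "continuous_on (P \<times> tuples n p r) (\<lambda>(c, x). x i)" for i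
    unfolding case_prod_unfold
    by (rule continuous_on_product_then_coordinatewise[OF continuous_on_snd[OF continuous_on_id]])
  moreover have "continuous_on (P \<times> tuples n p r) (\<lambda>(c, x). G c q (x i))" if "i < n" "q < Suc p" for i q
    unfolding G_def
  proof (rule series)
    have U: "x i \<in> U q" if "x \<in> tuples n p r" for x
      using tuples_in_U[OF that \<open>i < n\<close>, of q] \<open>q < Suc p\<close> by simp
    show "\<bar>E j q (x i)\<bar> \<le> 2" if "x \<in> tuples n p r" for j x
      using U[OF that] by (intro abs_E_le) (auto simp: U_def)
    have "continuous_on (U q) (E j q)" for j
      by (intro continuous_at_imp_continuous_on ballI E_isCont) (auto simp: U_def)
    then show "continuous_on (tuples n p r) (\<lambda>x. E j q (x i))" for j
      by (rule continuous_on_compose2[OF _ coord]) (use U in auto)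
  qed
  moreover have "continuous_on (P \<times> tuples n p r) (\<lambda>(c, x). G c q (a i))" for i q
    unfolding G_def by (rule series[of "\<lambda>j x. E j q (a i)"]) (auto intro!: abs_E_le ai[simplified])
  moreover have "continuous_on (P \<times> tuples n p r) (\<lambda>(c, x). Gr c q (a i))" for i q
    unfolding Gr_def by (rule series[of "\<lambda>j x. Er j q (a i)"]) (auto intro!: abs_Er_le ai[simplified])
  ultimately show ?thesis
    using \<phi> unfolding set_coord_funs by blast
qed

lemma closed_bad:
  assumes M: "\<forall>c\<in>P. \<forall>i. \<bar>c i\<bar> \<le> M i" "summable M" and "compact P"
  shows "closed (bad P n p k r J R)"
proof -
  let ?S = "P \<times> tuples n p r" and ?L = "length (coord_funs n p k)"
  have S: "compact ?S" by (intro compact_Times assms(3) compact_tuples)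
  have cont: "continuous_on ?S (\<lambda>z. coords n p k z v)" for v
    using continuous_on_coord_funs[OF M nth_mem[of v "coord_funs n p k"]] unfolding coords_def[abs_def]
    by (cases "v < ?L") auto
  have "closed (\<Inter>v\<in>{..<?L}. {z \<in> ?S. algebraic_relation a J (R ! v) v (coords n p k z)})"
    by (intro closed_INT ballI closed_algebraic_relation compact_imp_closed[OF S] cont)
  then have "compact (?S \<inter> (\<Inter>v\<in>{..<?L}. {z \<in> ?S. algebraic_relation a J (R ! v) v (coords n p k z)}))"
    by (rule compact_Int_closed[OF S])
  moreover have "?S \<inter> (\<Inter>v\<in>{..<?L}. {z \<in> ?S. algebraic_relation a J (R ! v) v (coords n p k z)}) =
      {z \<in> ?S. \<forall>v<?L. algebraic_relation a J (R ! v) v (coords n p k z)}" by blast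
  ultimately show ?thesis
    unfolding bad_def
    by (intro compact_imp_closed compact_continuous_image continuous_on_fst continuous_on_id) simp
qed

lemma strongly_transcendental_gfun:
  assumes c: "summable (\<lambda>i. \<bar>c i\<bar>)" "c \<in> P"
    and good: "\<And>n p k r J R. k \<le> p \<Longrightarrow> card (set J) < card (need n p k) \<Longrightarrow> c \<notin> bad P n p k r J R"
  shows "strongly_transcendental a (gfun c)"
  unfolding strongly_transcendental_def
proof (intro allI impI)
  fix n k and xs :: "real list"
  assume xs: "length xs = n \<and> distinct xs \<and> set xs \<subseteq> {-1<..<1} - range a"
  show "\<exists>C::nat. \<forall>p\<ge>k. ereal (real n * (real p + 2) + (real k + 1) * (2 * real p + 3)
                - (real k + 1) * (real k + 2) / 2 - real C)
         \<le> ereal_of_enat (trdeg_tuple (xs @ map a [0..<Suc k] @ jet_tuple a p k (gfun c) xs))"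
  \<comment> \<open>With n subtracted for x and k + 1 for a_0, ..., a_k, the bound becomes exactly
    \<open>card (need n p k)\<close>.\<close>
  proof (intro exI[of _ "n + Suc k"] allI impI)
    fix p assume k: "k \<le> p"
    define x where "x i = (if i < n then xs ! i else 0)" for i
    have mx: "map x [0..<n] = xs" using xs by (intro nth_equalityI) (auto simp: x_def)
    have x: "x i \<in> {-1<..<1} - range a" if "i < n" for i
      using xs that subsetD[OF _ nth_mem[of i xs], of "{-1<..<1} - range a"] by (simp add: x_def)
    have "inj_on x {..<n}"
      using xs by (auto simp: inj_on_def x_def nth_eq_iff_index_eq)
    then obtain r where r: "x \<in> tuples n p r"
      using exists_tuples[of x n p] x by (auto simp: x_def)
    let ?F = "coord_funs n p k" and ?y = "coords n p k (c, x)"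
    let ?Y = "map (\<lambda>\<phi>. \<phi> (c, x)) ?F"
    have Y: "?Y = xs @ jet_tuple a p k (gfun c) xs"
      using map_coord_funs[OF c(1) x, where p = p and k = k] by (simp add: mx)
    obtain bs where bs: "set bs \<subseteq> set ?Y" "indep_list (range a) bs" "set ?Y \<subseteq> acl (range a \<union> set bs)"
      using exists_acl_basis by blast
    have len: "card (need n p k) \<le> length bs"
    proof (rule ccontr)
      assume "\<not> card (need n p k) \<le> length bs"
      have "\<exists>v<length ?F. b = ?y v" if "b \<in> set bs" for b
        using that bs(1) unfolding coords_image[symmetric] by blast
      then obtain idx where idx: "\<And>b. b \<in> set bs \<Longrightarrow> b = ?y (idx b)" by metis
      \<comment> \<open>The positions of a transcendence basis in the coordinate list: if it were
        too short, these positions would witness that c is bad.\<close>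
      let ?J = "map idx bs"
      have "?y ` set ?J = set bs" using idx by force
      then have "?y v \<in> acl (range a \<union> ?y ` set ?J)" if "v < length ?F" for v
        using that bs(3) unfolding coords_image[symmetric] by auto
      then have "\<exists>\<rho>. algebraic_relation a ?J \<rho> v ?y" if "v < length ?F" for v
        using that acl_iff_algebraic_relation by blast
      then obtain \<rho> where \<rho>: "\<And>v. v < length ?F \<Longrightarrow> algebraic_relation a ?J (\<rho> v) v ?y" by metis
      have "c \<in> bad P n p k r ?J (map \<rho> [0..<length ?F])"
        unfolding bad_def using c(2) r \<rho> by (intro image_eqI[of _ _ "(c, x)"]) auto
      moreover have "card (set ?J) < card (need n p k)"
        using card_length[of ?J] \<open>\<not> card (need n p k) \<le> length bs\<close> by simp
      ultimately show False using good[OF k] by blast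
    qed
    have "set bs \<subseteq> set (xs @ map a [0..<Suc k] @ jet_tuple a p k (gfun c) xs)"
      using bs(1) unfolding Y by auto
    then have "enat (length bs) \<le> trdeg_tuple (xs @ map a [0..<Suc k] @ jet_tuple a p k (gfun c) xs)"
      by (rule length_le_trdeg_tuple[OF bs(2)])
    then have "ereal_of_enat (enat (length bs)) \<le>
        ereal_of_enat (trdeg_tuple (xs @ map a [0..<Suc k] @ jet_tuple a p k (gfun c) xs))"
      by (simp only: ereal_of_enat_le_iff)
    moreover have "real n * (real p + 2) + (real k + 1) * (2 * real p + 3)
                - (real k + 1) * (real k + 2) / 2 - real (n + Suc k) \<le> real (length bs)"
    proof -
      \<comment> \<open>The restriction m \<le> p is due to the truncated subtraction.\<close>
      have sum: "real (\<Sum>i\<le>m. p - i) = (real m + 1) * real p - real m * (real m + 1) / 2" if "m \<le> p" for m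
        using that
      proof (induction m)
        case (Suc m)
        then show ?case by (simp add: of_nat_diff field_simps)
      qed simp
      have "real n * (real p + 2) + (real k + 1) * (2 * real p + 3)
                - (real k + 1) * (real k + 2) / 2 - real (n + Suc k) = real (card (need n p k))"
        unfolding card_need of_nat_add of_nat_mult using sum[OF k] by (simp add: field_simps)
      then show ?thesis using len by simp
    qed
    ultimately show "ereal (real n * (real p + 2) + (real k + 1) * (2 * real p + 3)
                - (real k + 1) * (real k + 2) / 2 - real (n + Suc k))
         \<le> ereal_of_enat (trdeg_tuple (xs @ map a [0..<Suc k] @ jet_tuple a p k (gfun c) xs))"
      by (simp only: ereal_of_enat_simps) (meson ereal_less_eq(3) order_trans)
  qed
qed

lemma good_coefficients_dense:
  fixes b \<delta> :: "nat \<Rightarrow> real"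
  defines "P \<equiv> {c. \<forall>i. b i - \<delta> i \<le> c i \<and> c i \<le> b i + \<delta> i}"
  assumes b: "finite {i. b i \<noteq> 0}" and \<delta>: "\<And>i. \<delta> i > 0"
    and k: "k \<le> p" and J: "card (set J) < card (need n p k)"
  shows "P \<subseteq> closure (P - bad P n p k r J R)"
proof
  fix c assume "c \<in> P"
  then have c: "\<And>i. b i - \<delta> i \<le> c i \<and> c i \<le> b i + \<delta> i" by (simp add: P_def)
  \<comment> \<open>Past N the box contains 0 in each coordinate, as b vanishes there, so cutting
    off a sequence does not leave P. N also bounds \<open>need n p k\<close>, as
    \<open>generic_not_bad\<close> requires.\<close>
  obtain N where N: "\<And>i. b i \<noteq> 0 \<Longrightarrow> i < N" "\<And>i. i \<in> need n p k \<Longrightarrow> i < N"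
    using finite_nat_set_iff_bounded[of "{i. b i \<noteq> 0} \<union> need n p k"] b finite_need[of n p k] by auto
  have "\<exists>c'. c' \<in> P - bad P n p k r J R \<and> (\<forall>i<m. \<bar>c' i - c i\<bar> < 1 / real (Suc m))" for m
  proof -
    let ?e = "1 / real (Suc m)"
    have e: "?e > 0" by simp
    \<comment> \<open>The open side of the box meets the 1/(m+1)-neighbourhood of \<open>c i\<close>
      even if \<open>c i\<close> is an end point, because \<open>\<delta> i > 0\<close>.\<close>
    have "max (c i - ?e) (b i - \<delta> i) < min (c i + ?e) (b i + \<delta> i)" for i
      unfolding max_less_iff_conj min_less_iff_conj using c[of i] \<delta>[of i] e by (intro conjI; linarith)
    then obtain d where d: "\<And>i. i < m + N \<Longrightarrow> max (c i - ?e) (b i - \<delta> i) < d i \<and> d i < min (c i + ?e) (b i + \<delta> i)"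
      "indep_list (range a) (map d [0..<m + N])"
      using exists_indep_in_intervals[of "range a" "\<lambda>i. max (c i - ?e) (b i - \<delta> i)" "\<lambda>i. min (c i + ?e) (b i + \<delta> i)" "m + N"]
      by blast
    define c' where "c' i = (if i < m + N then d i else 0)" for i
    have "map c' [0..<m + N] = map d [0..<m + N]" by (auto simp: c'_def)
    then have "indep_list (range a) (map c' [0..<m + N])"
      using d(2) by (simp only:)
    then have "c' \<notin> bad P n p k r J R"
      using N(2) by (intro generic_not_bad[of "m + N"] k J) (auto simp: c'_def trans_less_add2)
    moreover have "c' \<in> P"
      unfolding P_def mem_Collect_eq
    proof
      fix i
      show "b i - \<delta> i \<le> c' i \<and> c' i \<le> b i + \<delta> i"
      proof (cases "i < m + N")
        case True
        then show ?thesis using d(1)[of i] by (auto simp: c'_def)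
      next
        case False
        then have "b i = 0" using N(1)[of i] by auto
        then show ?thesis using False \<delta>[of i] by (simp add: c'_def)
      qed
    qed
    moreover have "\<bar>c' i - c i\<bar> < ?e" if "i < m" for i
      using d(1)[of i] that unfolding c'_def by (simp add: abs_less_iff; linarith)
    ultimately show ?thesis by blast
  qed
  then obtain c' where c': "\<And>m. c' m \<in> P - bad P n p k r J R" "\<And>m i. i < m \<Longrightarrow> \<bar>c' m i - c i\<bar> < 1 / real (Suc m)"
    by metis
  have "c' \<longlonglongrightarrow> c"
  proof (rule tendsto_fun_nat)
    fix i
    have "(\<lambda>m. c' m i - c i) \<longlonglongrightarrow> 0"
    proof (rule Lim_null_comparison)
      show "eventually (\<lambda>m. norm (c' m i - c i) \<le> 1 / real (Suc m)) sequentially"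
        using eventually_gt_at_top[of i] by eventually_elim (use c'(2) in \<open>auto intro: less_imp_le simp del: of_nat_Suc\<close>)
      show "(\<lambda>m. 1 / real (Suc m)) \<longlonglongrightarrow> 0"
        using LIMSEQ_inverse_real_of_nat by (simp add: inverse_eq_divide)
    qed
    then show "(\<lambda>m. c' m i) \<longlonglongrightarrow> c i" by (rule LIM_zero_cancel)
  qed
  moreover have "c' m \<in> closure (P - bad P n p k r J R)" for m
    using c'(1)[of m] closure_subset by blast
  ultimately show "c \<in> closure (P - bad P n p k r J R)"
    by (intro Lim_in_closed_set[of _ c' sequentially]) auto
qed

lemma exists_strongly_transcendental_near:
  fixes b \<delta> :: "nat \<Rightarrow> real"
  assumes b: "finite {i. b i \<noteq> 0}" and \<delta>: "\<And>i. \<delta> i > 0" "summable \<delta>"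
  shows "\<exists>c. (\<forall>i. \<bar>c i - b i\<bar> \<le> \<delta> i) \<and> strongly_transcendental a (gfun c)"
proof -
  define P where "P = {c. \<forall>i. b i - \<delta> i \<le> c i \<and> c i \<le> b i + \<delta> i}"
  have "compact P" unfolding P_def by (rule compact_box)
  have M: "\<bar>c i\<bar> \<le> \<bar>b i\<bar> + \<delta> i" if "c \<in> P" for c i
  proof -
    have "b i - \<delta> i \<le> c i \<and> c i \<le> b i + \<delta> i" using that by (simp add: P_def)
    then show ?thesis by linarith
  qed
  have sM: "summable (\<lambda>i. \<bar>b i\<bar> + \<delta> i)"
    by (intro summable_add summable_finite_support b \<delta>)
  \<comment> \<open>All components, including the lists of \<open>pexp\<close>, have countable
    types, so the family of sets is countable.\<close>
  define I where "I = {(n, p, k, r :: nat, J :: nat list, R :: (pexp list \<times> nat \<times> nat) list). k \<le> p \<and> card (set J) < card (need n p k)}"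
  define \<G> where "\<G> = (\<lambda>(n, p, k, r, J, R). P - bad P n p k r J R) ` I"
  have "top_of_set P closure_of \<Inter>\<G> = topspace (top_of_set P)"
  proof (rule Baire_category)
    have "compact_space (top_of_set P)"
      using \<open>compact P\<close> by (simp add: compact_space_subtopology)
    moreover have "Hausdorff_space (top_of_set P)"
      by (simp add: Hausdorff_space_subtopology)
    ultimately show "completely_metrizable_space (top_of_set P) \<or> locally_compact_space (top_of_set P) \<and> regular_space (top_of_set P)"
      using compact_Hausdorff_imp_regular_space compact_imp_locally_compact_space by blast
    show "countable \<G>" unfolding \<G>_def by (rule countable_image) simp
    fix T assume "T \<in> \<G>"
    then obtain n p k r J R where T: "T = P - bad P n p k r J R" "k \<le> p" "card (set J) < card (need n p k)"
      by (auto simp: \<G>_def I_def)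
    have "openin (top_of_set P) T"
      unfolding T(1) openin_open
      using closed_bad[OF _ sM \<open>compact P\<close>, of n p k r J R]
      using M by (intro exI[of _ "- bad P n p k r J R"]) auto
    moreover have "P \<subseteq> closure T"
      unfolding T(1) P_def by (rule good_coefficients_dense[OF b \<delta>(1) T(2,3)])
    then have "top_of_set P closure_of T = topspace (top_of_set P)"
      unfolding closure_of_subtopology using T(1) by (auto simp: Int_absorb1)
    ultimately show "openin (top_of_set P) T \<and> top_of_set P closure_of T = topspace (top_of_set P)" by blast
  qed
  \<comment> \<open>The intersection is dense in P, and b shows that P is nonempty.\<close>
  moreover have "b \<in> P" using \<delta>(1) by (auto simp: P_def intro: less_imp_le)
  ultimately have "P \<inter> \<Inter>\<G> \<noteq> {}"
    unfolding closure_of_subtopology by auto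
  then obtain c where c: "c \<in> P" "\<And>T. T \<in> \<G> \<Longrightarrow> c \<in> T" by blast
  have "summable (\<lambda>i. \<bar>c i\<bar>)"
    by (rule summable_comparison_test'[OF sM, of 0]) (use M[OF c(1)] in auto)
  moreover have "c \<notin> bad P n p k r J R" if "k \<le> p" "card (set J) < card (need n p k)" for n p k r J R
  proof -
    have "P - bad P n p k r J R \<in> \<G>"
      unfolding \<G>_def I_def using that by (intro image_eqI[of _ _ "(n, p, k, r, J, R)"]) auto
    then show ?thesis using c(2) by blast
  qed
  ultimately have "strongly_transcendental a (gfun c)"
    using c(1) by (intro strongly_transcendental_gfun[of c P]) auto
  moreover have "\<bar>c i - b i\<bar> \<le> \<delta> i" for i
  proof -
    have "b i - \<delta> i \<le> c i \<and> c i \<le> b i + \<delta> i" using c(1) by (simp add: P_def)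
    then show ?thesis by linarith
  qed
  ultimately show ?thesis by blast
qed

end

subsection \<open>Density\<close>

lemma compact_subset_symmetric_interval:
  assumes "compact K" "K \<subseteq> {-1<..<1::real}"
  obtains \<rho> where "0 < \<rho>" "\<rho> < 1" "K \<subseteq> {-\<rho>..\<rho>}"
proof (cases "K = {}")
  case True
  then show ?thesis by (intro that[of "1/2"]) auto
next
  case False
  have "continuous_on K (\<lambda>x. \<bar>x\<bar>)" by (intro continuous_intros)
  then obtain m where m: "m \<in> K" "\<And>x. x \<in> K \<Longrightarrow> \<bar>x\<bar> \<le> \<bar>m\<bar>"
    using continuous_attains_sup[OF assms(1) False] by blast
  then have "\<bar>m\<bar> < 1" using assms(2) by (auto simp: abs_less_iff)
  then show ?thesis
    \<comment> \<open>The maximum with 1/2 keeps \<rho> positive when K is {0}.\<close>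
    using m(2) by (intro that[of "max \<bar>m\<bar> (1/2)"]) (auto simp: abs_le_iff le_max_iff_disj, force+)
qed

context singular_points
begin

lemma V_deriv_diff:
  assumes "f \<in> V_space a" "g \<in> V_space a" "x \<in> U q"
  shows "(deriv ^^ q) (\<lambda>x. f x - g x) x = (deriv ^^ q) f x - (deriv ^^ q) g x"
  using assms(3)
proof (induction q arbitrary: x)
  case (Suc q)
  have "eventually (\<lambda>y. y \<in> U q) (nhds x)"
    using Suc.prems U_antimono[of q "Suc q"] open_U by (intro eventually_nhds_in_open) auto
  then have "eventually (\<lambda>y. (deriv ^^ q) (\<lambda>x. f x - g x) y = (deriv ^^ q) f y - (deriv ^^ q) g y) (nhds x)"
    by eventually_elim (rule Suc.IH)
  then have "deriv ((deriv ^^ q) (\<lambda>x. f x - g x)) x = deriv (\<lambda>y. (deriv ^^ q) f y - (deriv ^^ q) g y) x"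
    by (rule deriv_cong_ev) simp
  also have "\<dots> = (deriv ^^ Suc q) f x - (deriv ^^ Suc q) g x"
    by (intro DERIV_imp_deriv DERIV_diff V_has_derivative assms Suc.prems)
  finally show ?case by simp
qed simp

text \<open>The subbasic sets are balls around arbitrary centres h, with f anywhere inside, so the
  radius comes from the slack at f. Intersections take the larger interval and order and the smaller
  radius.\<close>

lemma V_open_contains_ball:
  assumes "openin (V_topology a) W" "f \<in> W"
  shows "\<exists>\<rho> p e. 0 < \<rho> \<and> \<rho> < 1 \<and> 0 < e \<and>
    (\<forall>g\<in>V_space a. (\<forall>q\<le>p. \<forall>x\<in>{-\<rho>..\<rho>} - range a. \<bar>(deriv ^^ q) g x - (deriv ^^ q) f x\<bar> \<le> e) \<longrightarrow> g \<in> W)"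
    (is "?P W")
proof -
  have "generate_topology_on {{g \<in> V_space a. V_seminorm a K p (\<lambda>x. g x - f x) < e} | f K p e.
        f \<in> V_space a \<and> compact K \<and> K \<subseteq> {-1<..<1} \<and> e > 0} W"
    using assms(1) unfolding V_topology_def by (simp add: openin_topology_generated_by_iff)
  then show ?thesis using assms(2)
  proof induction
    case Empty
    then show ?case by simp
  next
    case (Int A B)
    have "?P A" using Int by blast
    then obtain \<rho> p e where A: "0 < \<rho>" "\<rho> < 1" "0 < e" "\<And>g. g \<in> V_space a \<Longrightarrow>
        (\<forall>q\<le>p. \<forall>x\<in>{-\<rho>..\<rho>} - range a. \<bar>(deriv ^^ q) g x - (deriv ^^ q) f x\<bar> \<le> e) \<Longrightarrow> g \<in> A"
      by blast
    have "?P B" using Int by blast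
    then obtain \<rho>' p' e' where B: "0 < \<rho>'" "\<rho>' < 1" "0 < e'" "\<And>g. g \<in> V_space a \<Longrightarrow>
        (\<forall>q\<le>p'. \<forall>x\<in>{-\<rho>'..\<rho>'} - range a. \<bar>(deriv ^^ q) g x - (deriv ^^ q) f x\<bar> \<le> e') \<Longrightarrow> g \<in> B"
      by blast
    show ?case
    proof (rule exI[of _ "max \<rho> \<rho>'"], rule exI[of _ "max p p'"], rule exI[of _ "min e e'"],
        intro conjI ballI impI)
      fix g assume g: "g \<in> V_space a" "\<forall>q\<le>max p p'. \<forall>x\<in>{- max \<rho> \<rho>'..max \<rho> \<rho>'} - range a.
        \<bar>(deriv ^^ q) g x - (deriv ^^ q) f x\<bar> \<le> min e e'"
      have close: "\<bar>(deriv ^^ q) g x - (deriv ^^ q) f x\<bar> \<le> min e e'"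
        if "q \<le> p \<or> q \<le> p'" "x \<in> {-\<rho>..\<rho>} \<union> {-\<rho>'..\<rho>'} - range a" for q x
      proof -
        have "q \<le> max p p'" "x \<in> {- max \<rho> \<rho>'..max \<rho> \<rho>'} - range a" using that by auto
        then show ?thesis using g(2) by blast
      qed
      have "g \<in> A" by (rule A(4)[OF g(1)]) (use close in auto)
      moreover have "g \<in> B" by (rule B(4)[OF g(1)]) (use close in auto)
      ultimately show "g \<in> A \<inter> B" by blast
    qed (use A B in auto)
  next
    case (UN \<K>)
    then obtain k where k: "k \<in> \<K>" "f \<in> k" by blast
    then have "?P k" using UN.IH by blast
    then show ?case using k(1) by blast
  next
    case (Basis s)
    then obtain h K p e where s: "s = {g \<in> V_space a. V_seminorm a K p (\<lambda>x. g x - h x) < e}"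
      and h: "h \<in> V_space a" and K: "compact K" "K \<subseteq> {-1<..<1}" and e: "e > 0" by blast
    have f: "f \<in> V_space a" "V_seminorm a K p (\<lambda>x. f x - h x) < e" using Basis.prems s by auto
    obtain \<rho> where \<rho>: "0 < \<rho>" "\<rho> < 1" "K \<subseteq> {-\<rho>..\<rho>}" by (rule compact_subset_symmetric_interval[OF K])
    show ?case
    proof (cases "K \<subseteq> range a")
      case True
      \<comment> \<open>Here the seminorm is constantly 0 and s is all of \<open>V_space a\<close>,
        so any radius will do.\<close>
      then show ?thesis using \<rho> e by (intro exI[of _ \<rho>] exI[of _ 0] exI[of _ 1]) (auto simp: s V_seminorm_def)
    next
      case False
      define A where "A g = {\<bar>(deriv ^^ q) (\<lambda>x. g x - h x) x\<bar> | x q. x \<in> K - range a \<and> q \<le> p}" for g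
      have sn: "V_seminorm a K p (\<lambda>x. g x - h x) = Sup (A g)" for g
        using False by (simp add: V_seminorm_def A_def)
      have A: "A g = {\<bar>(deriv ^^ q) g x - (deriv ^^ q) h x\<bar> | x q. x \<in> K - range a \<and> q \<le> p}"
        if "g \<in> V_space a" for g
      proof -
        have "(deriv ^^ q) (\<lambda>x. g x - h x) x = (deriv ^^ q) g x - (deriv ^^ q) h x" if "x \<in> K - range a" for x q
          using that K(2) by (intro V_deriv_diff \<open>g \<in> V_space a\<close> h not_range_in_U) auto
        then show ?thesis unfolding A_def by (intro Collect_cong ex_cong1) auto
      qed
      obtain Mf where Mf: "\<And>q x. q \<le> p \<Longrightarrow> x \<in> {-\<rho>..\<rho>} - range a \<Longrightarrow> \<bar>(deriv ^^ q) f x\<bar> \<le> Mf"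
        using V_deriv_bounded[OF f(1) \<rho>(1,2), of p] by blast
      obtain Mh where Mh: "\<And>q x. q \<le> p \<Longrightarrow> x \<in> {-\<rho>..\<rho>} - range a \<Longrightarrow> \<bar>(deriv ^^ q) h x\<bar> \<le> Mh"
        using V_deriv_bounded[OF h \<rho>(1,2), of p] by blast
      have "bdd_above (A f)"
      proof (rule bdd_aboveI)
        fix t assume "t \<in> A f"
        then obtain x q where "x \<in> K - range a" "q \<le> p" "t = \<bar>(deriv ^^ q) f x - (deriv ^^ q) h x\<bar>"
          unfolding A[OF f(1)] by blast
        then show "t \<le> Mf + Mh" using Mf[of q x] Mh[of q x] \<rho>(3) by fastforce
      qed
      then have le: "\<bar>(deriv ^^ q) f x - (deriv ^^ q) h x\<bar> \<le> Sup (A f)" if "x \<in> K - range a" "q \<le> p" for x q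
        using that by (intro cSup_upper) (auto simp: A[OF f(1)])
      \<comment> \<open>Half of the slack, because the supremum yields a non-strict bound only and
        membership in s is strict.\<close>
      define \<epsilon> where "\<epsilon> = (e - Sup (A f)) / 2"
      have \<epsilon>: "\<epsilon> > 0" "Sup (A f) + \<epsilon> < e" using f(2) by (auto simp: sn \<epsilon>_def field_simps)
      have "g \<in> s" if g: "g \<in> V_space a"
        "\<forall>q\<le>p. \<forall>x\<in>{-\<rho>..\<rho>} - range a. \<bar>(deriv ^^ q) g x - (deriv ^^ q) f x\<bar> \<le> \<epsilon>" for g
      proof -
        have "Sup (A g) \<le> Sup (A f) + \<epsilon>"
        proof (rule cSup_least)
          show "A g \<noteq> {}" using False by (auto simp: A_def)
          fix t assume "t \<in> A g"
          then obtain x q where t: "x \<in> K - range a" "q \<le> p" "t = \<bar>(deriv ^^ q) g x - (deriv ^^ q) h x\<bar>"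
            unfolding A[OF g(1)] by blast
          moreover have "\<bar>(deriv ^^ q) g x - (deriv ^^ q) f x\<bar> \<le> \<epsilon>"
            using g(2) t \<rho>(3) by blast
          ultimately show "t \<le> Sup (A f) + \<epsilon>" using le[OF t(1,2)] by linarith
        qed
        then show ?thesis using g(1) \<epsilon>(2) by (simp add: s sn)
      qed
      then show ?thesis using \<rho> \<epsilon>(1) by blast
    qed
  qed
qed

lemma G_diff:
  assumes "summable (\<lambda>i. \<bar>c i\<bar>)" "summable (\<lambda>i. \<bar>b i\<bar>)" "x \<in> {-1<..<1}"
  shows "G c q x - G b q x = G (\<lambda>i. c i - b i) q x"
  unfolding G_def using suminf_diff[OF summable_G[OF assms(1,3), of q] summable_G[OF assms(2,3), of q]]
  by (simp add: left_diff_distrib)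

lemma strongly_transcendental_approximation:
  assumes f: "f \<in> V_space a" and \<rho>: "0 < \<rho>" "\<rho> < 1" and e: "0 < e"
  obtains g where "g \<in> V_space a" "strongly_transcendental a g"
    "\<And>q x. q \<le> p \<Longrightarrow> x \<in> {-\<rho>..\<rho>} - range a \<Longrightarrow> \<bar>(deriv ^^ q) g x - (deriv ^^ q) f x\<bar> \<le> e"
proof -
  obtain b where b: "finite {i. b i \<noteq> 0}"
    "\<And>q x. q \<le> p \<Longrightarrow> x \<in> {-\<rho>..\<rho>} \<Longrightarrow> x \<in> U q \<Longrightarrow> \<bar>(deriv ^^ q) f x - G b q x\<bar> \<le> e / 2"
    using spline_approximation[OF f \<rho>, of "e / 2" p] e by auto
  \<comment> \<open>The sum of \<delta> is e/4; the factor 2 in \<open>abs_G_le\<close> turns it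
    into e/2, which the spline error completes to e.\<close>
  define \<delta> where "\<delta> i = e / 8 * (1 / 2) ^ i" for i :: nat
  have s\<delta>: "\<delta> sums (e / 4)"
    using sums_mult[OF geometric_sums[of "1 / 2 :: real"], of "e / 8"] by (simp add: \<delta>_def[abs_def])
  have "\<delta> i > 0" for i using e by (simp add: \<delta>_def)
  then obtain c where c: "\<And>i. \<bar>c i - b i\<bar> \<le> \<delta> i" "strongly_transcendental a (gfun c)"
    using exists_strongly_transcendental_near[OF b(1), of \<delta>] s\<delta> by (auto simp: sums_iff)
  note sb = summable_finite_support[OF b(1)]
  have scb: "summable (\<lambda>i. \<bar>c i - b i\<bar>)"
    by (rule summable_comparison_test'[of \<delta> 0]) (use s\<delta> c(1) in \<open>auto simp: sums_iff\<close>)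
  have sc: "summable (\<lambda>i. \<bar>c i\<bar>)"
  proof (rule summable_comparison_test'[OF summable_add[OF scb sb], of 0])
    show "norm \<bar>c i\<bar> \<le> \<bar>c i - b i\<bar> + \<bar>b i\<bar>" for i by simp
  qed
  have "suminf (\<lambda>i. \<bar>c i - b i\<bar>) \<le> suminf \<delta>"
    using s\<delta> by (intro suminf_le scb c(1)) (auto simp: sums_iff)
  then have sum: "suminf (\<lambda>i. \<bar>c i - b i\<bar>) \<le> e / 4" using s\<delta> by (simp add: sums_iff)
  show ?thesis
  proof (rule that[OF gfun_in_V[OF sc] c(2)])
    fix q x assume q: "q \<le> p" and x: "x \<in> {-\<rho>..\<rho>} - range a"
    have x1: "x \<in> {-1<..<1}" using x \<rho> by auto
    have U: "x \<in> U q" using x x1 by (intro not_range_in_U) auto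
    have "\<bar>G c q x - G b q x\<bar> \<le> e / 2"
      using abs_G_le[OF scb x1, of q] sum G_diff[OF sc sb x1, of q] by linarith
    moreover have "\<bar>(deriv ^^ q) f x - G b q x\<bar> \<le> e / 2" using b(2)[OF q _ U] x by blast
    ultimately show "\<bar>(deriv ^^ q) (gfun c) x - (deriv ^^ q) f x\<bar> \<le> e"
      unfolding deriv_gfun[OF sc U] by linarith
  qed
qed

end

theorem mainTheorem5:
  fixes a :: "nat \<Rightarrow> real"
  assumes "inj a"
    and "range a \<subseteq> {-1<..<1}"
    and "{-1<..<1} \<subseteq> closure (range a)"
  shows "V_topology a closure_of {f \<in> V_space a. strongly_transcendental a f} = V_space a"
proof -
  interpret singular_points a by unfold_locales fact+
  show ?thesis
  proof (intro equalityI subsetI)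
    fix f assume f: "f \<in> V_space a"
    show "f \<in> V_topology a closure_of {f \<in> V_space a. strongly_transcendental a f}"
      unfolding in_closure_of
    proof (intro conjI allI impI)
      fix W assume "f \<in> W \<and> openin (V_topology a) W"
      then obtain \<rho> p e where W: "0 < \<rho>" "\<rho> < 1" "0 < e"
        "\<And>g. g \<in> V_space a \<Longrightarrow> (\<forall>q\<le>p. \<forall>x\<in>{-\<rho>..\<rho>} - range a. \<bar>(deriv ^^ q) g x - (deriv ^^ q) f x\<bar> \<le> e) \<Longrightarrow> g \<in> W"
        using V_open_contains_ball by metis
      obtain g where "g \<in> V_space a" "strongly_transcendental a g"
        "\<And>q x. q \<le> p \<Longrightarrow> x \<in> {-\<rho>..\<rho>} - range a \<Longrightarrow> \<bar>(deriv ^^ q) g x - (deriv ^^ q) f x\<bar> \<le> e"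
        using strongly_transcendental_approximation[OF f W(1-3)] by blast
      then show "\<exists>g. g \<in> {f \<in> V_space a. strongly_transcendental a f} \<and> g \<in> W"
        using W(4) by blast
    qed (simp add: f)
  qed (use closure_of_subset_topspace[of "V_topology a"] in auto)
qed

end
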